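(* Let $X$ be a non-negative random variable with distribution $F_X$ such that $\psi_{F_X}(\lambda)=\mathbb{E}[\log(1+\lambda X)]<\infty$ for all $\lambda>0$, and for each $c>0$ let $A_c\overset{d}{=}cX/(cX+1)$, with distribution $F_{A_c}$. For $\theta>0$ let $T_\theta=G_\theta M_\theta(F_X)$ be a $\mathrm{GGC}(\theta,F_X)$ random variable having density $g_{\theta,F_X}$. Let $\tilde T_{\theta,c}$ be a random variable with density $$e^{-t}\,(1/c)\,g_{\theta,F_X}(t/c)\,e^{\theta\psi_{F_X}(c)},\qquad t>0,$$ and Laplace transform $$\frac{\mathbb{E}[e^{-c(1+\lambda)G_\theta M_\theta(F_X)}]}{\mathbb{E}[e^{-cG_\theta M_\theta(F_X)}]}=e^{-\theta[\psi_{F_X}(c(1+\lambda))-\psi_{F_X}(c)]}.$$ Then $\tilde T_{\theta,c}$ is a $\mathrm{GGC}(\theta,F_{A_c})$ random variable, hence representable as $G_\theta M_\theta(F_{A_c})$. Furthermore, the densities of $M_\theta(F_X)$ and $M_\theta(F_{A_c})$ are related as follows. (i) Suppose $M_\theta(F_X)$ has density $\xi_{\theta F_X}$. Then the density of $M_\theta(F_{A_c})$ is $$\xi_{\theta F_{A_c}}(y)=\frac1c\,e^{\theta\psi_{F_X}(c)}(1-y)^{\theta-2}\,\xi_{\theta F_X}\!\left(\frac{y}{c(1-y)}\right),\qquad 0<y<1.$$ (ii) Conversely, if $M_\theta(F_{A_1})$ (that is, $c=1$) has density $\xi_{\theta F_{A_1}}$, then the density of $M_\theta(F_X)$ is $$\xi_{\theta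 F_X}(x)=(1+x)^{\theta-2}\,\xi_{\theta F_{A_1}}\!\left(\frac{x}{1+x}\right)e^{-\theta\psi_{F_X}(1)},\qquad x>0.$$
   Context: Dirichlet process and Dirichlet mean: for $\theta>0$ and a probability distribution $F$ on $[0,\infty)$, a Dirichlet process $P_\theta$ with total mass $\theta$ and parameter $F$ is a random probability measure on $[0,\infty)$ such that for every finite measurable partition $(C_1,\dots,C_k)$ of $[0,\infty)$ the vector $(P_\theta(C_1),\dots,P_\theta(C_k))$ is Dirichlet distributed with parameters $(\theta F(C_1),\dots,\theta F(C_k))$. The Dirichlet mean is $M_\theta(F)\overset{d}{=}\int_0^\infty x\,P_\theta(dx)$; it is finite if and only if $\psi_F(\lambda):=\int_0^\infty\log(1+\lambda x)F(dx)<\infty$ for $\lambda>0$. $G_\theta$ denotes a gamma$(\theta,1)$ random variable; in products the factors are independent. $\mathrm{GGC}(\theta,F)$ denotes the law of $G_\theta M_\theta(F)$, whose Laplace transform is $e^{-\theta\psi_F(\lambda)}$, $\lambda\ge0$. Densities are with respect to Lebesgue measure, up to null sets. *)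

theory Defs
  imports "HOL-Probability.Probability"
begin

definition nonneg_borel :: "real measure" where
  "nonneg_borel = restrict_space borel {0..}"

(* gamma(a,1) for a \<ge> 0; shape 0 is the point mass at 0, which the Dirichlet distribution needs
   because some of its parameters may vanish. *)
definition gamma_law :: "real \<Rightarrow> real measure" where
  "gamma_law a = (if a = 0 then return borel 0 else
     density lborel (\<lambda>x. ennreal (if 0 < x then x powr (a - 1) * exp (- x) / Gamma a else 0)))"

(* Independent gammas divided by their sum: for parameters a i \<ge> 0, not all zero, this is the
   Dirichlet distribution, coordinates with a i = 0 being zero almost surely. *)
definition dirichlet_law :: "'i set \<Rightarrow> ('i \<Rightarrow> real) \<Rightarrow> ('i \<Rightarrow> real) measure" where
  "dirichlet_law I a =
     distr (\<Pi>\<^sub>M i\<in>I. gamma_law (a i)) (\<Pi>\<^sub>M i\<in>I. borel) (\<lambda>y. \<lambda>i\<in>I. y i / (\<Sum>j\<in>I. y j))"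

(* The state space is that of F; prob_algebra F depends on F only through its sigma-algebra. *)
definition dirichlet_process ::
    "'w measure \<Rightarrow> real \<Rightarrow> 'a measure \<Rightarrow> ('w \<Rightarrow> 'a measure) \<Rightarrow> bool" where
  "dirichlet_process W \<theta> F P \<longleftrightarrow>
     prob_space W \<and> P \<in> W \<rightarrow>\<^sub>M prob_algebra F \<and>
     (\<forall>k (C :: nat \<Rightarrow> 'a set).
        (\<forall>i<k. C i \<in> sets F) \<and> disjoint_family_on C {..<k} \<and> (\<Union>i<k. C i) = space F \<longrightarrow>
        distr W (\<Pi>\<^sub>M i\<in>{..<k}. borel) (\<lambda>\<omega>. \<lambda>i\<in>{..<k}. measure (P \<omega>) (C i)) =
        dirichlet_law {..<k} (\<lambda>i. \<theta> * measure F (C i)))"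

definition psi :: "real measure \<Rightarrow> real \<Rightarrow> real" where
  "psi F l = (\<integral>x. ln (1 + l * x) \<partial>F)"

(* mu is the law of M_theta(F). Fixing the type of the underlying probability space loses nothing:
   any Dirichlet process can be replaced by the identity on the space of measures, equipped with
   the law of the process. The Bochner integral is 0 where x is not integrable; this is a null
   event whenever psi F is finite. *)
definition dirichlet_mean_law :: "real \<Rightarrow> real measure \<Rightarrow> real measure \<Rightarrow> bool" where
  "dirichlet_mean_law \<theta> F \<mu> \<longleftrightarrow>
     (\<exists>(W :: real measure measure) P. dirichlet_process W \<theta> F P \<and>
        \<mu> = distr W borel (\<lambda>\<omega>. \<integral>x. x \<partial>P \<omega>))"

definition is_GGC :: "real \<Rightarrow> real measure \<Rightarrow> real measure \<Rightarrow> bool" where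
  "is_GGC \<theta> F \<nu> \<longleftrightarrow>
     (\<exists>\<mu>. dirichlet_mean_law \<theta> F \<mu> \<and>
        \<nu> = distr (gamma_law \<theta> \<Otimes>\<^sub>M \<mu>) borel (\<lambda>(g, m). g * m))"

end

theory Submission
  imports Defs
begin

text \<open>
  Write \<open>\<mu>\<close> for the law of the Dirichlet mean of \<open>FX\<close>, and \<open>\<psi>\<close> for \<open>psi FX\<close>. If \<open>G\<close> is a gamma variable with
  shape \<open>\<theta>\<close> and \<open>M\<close> an independent variable with law \<open>\<mu>\<close>, then \<open>E exp (- l * G * M) = E (1 + l * M) powr (- \<theta>)\<close>, so the Laplace
  transform of a GGC law is the Stieltjes transform of order \<open>\<theta>\<close> of the Dirichlet mean. The identity of
  Markov and Krein (\<open>Markov_Krein\<close>) evaluates the latter as \<open>exp (- \<theta> * \<psi> l)\<close>.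

  Everything then rests on the factorisation
  \<open>1 + c * (1 + l) * x = (1 + c * x) * (1 + l * (c * x / (1 + c * x)))\<close>. Its logarithm, integrated against
  \<open>FX\<close>, gives \<open>psi (FA c) l = \<psi> (c * (1 + l)) - \<psi> c\<close>, which is the exponent in the Laplace transform of the
  exponentially tilted variable \<open>T'\<close>; hence \<open>T'\<close> has a GGC law with parameter \<open>FA c\<close>. A Dirichlet process
  with that parameter is the image of a process with parameter \<open>FX\<close> (\<open>dirichlet_process_distr\<close>). The
  power \<open>- \<theta>\<close> of the factorisation shows that \<open>exp (\<theta> * \<psi> c) * (1 + c * m) powr (- \<theta>)\<close> times \<open>\<mu>\<close>, moved by
  \<open>m \<mapsto> c * m / (1 + c * m)\<close>, has the Stieltjes transform of the Dirichlet mean of \<open>FA c\<close>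
  (\<open>Stieltjes_transform_of_tilt\<close>), so by uniqueness it is the law of that mean. The density formulas
  are the substitution \<open>m = y / (c * (1 - y))\<close> in this relation, read in both directions.

  The identity of Markov and Krein is first proved for Dirichlet vectors, as a consequence of how
  independent gamma variables behave under rescaling (\<open>dirichlet_law_Stieltjes_transform\<close>). It passes
  to processes through simple functions, and letting \<open>l\<close> tend to \<open>0\<close> shows that the mean is finite almost
  surely. Uniqueness of Laplace and Stieltjes transforms is reduced to the unit interval: there the
  moments determine the characteristic function through its power series.
\<close>

section \<open>Gamma laws under rescaling\<close>

lemma sets_gamma_law [simp, measurable_cong]: "sets (gamma_law a) = sets borel"
  by (simp add: gamma_law_def)

lemma space_gamma_law [simp]: "space (gamma_law a) = UNIV"
  by (simp add: gamma_law_def)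

lemma nn_integral_gamma_law:
  assumes "a > 0" and [measurable]: "f \<in> borel_measurable borel"
  shows "(\<integral>\<^sup>+x. f x \<partial>gamma_law a) =
    (\<integral>\<^sup>+x. ennreal (if 0 < x then x powr (a - 1) * exp (- x) / Gamma a else 0) * f x \<partial>lborel)"
  using assms(1) by (simp add: gamma_law_def nn_integral_density)

lemma prob_space_gamma_law:
  assumes "a \<ge> 0"
  shows "prob_space (gamma_law a)"
proof (cases "a = 0")
  case True
  then show ?thesis by (simp add: gamma_law_def prob_space_return)
next
  case False
  with assms have a: "a > 0" by simp
  have "(\<integral>\<^sup>+x. 1 \<partial>gamma_law a) =
      (\<integral>\<^sup>+x. ennreal (1 / Gamma a) * ennreal (indicator {0..} x * (x powr (a - 1) / exp x)) \<partial>lborel)"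
    unfolding nn_integral_gamma_law[OF a borel_measurable_const]
    by (intro nn_integral_cong)
       (use a in \<open>auto simp: indicator_def exp_minus field_simps ennreal_mult[symmetric] Gamma_real_pos less_imp_le\<close>)
  also have "\<dots> = ennreal (1 / Gamma a) * ennreal (Gamma a)"
    using nn_integral_has_integral_lebesgue[OF _ Gamma_integral_real[OF a]] a
    by (subst nn_integral_cmult) (auto simp: ennreal_mult')
  also have "\<dots> = 1"
    using Gamma_real_pos[OF a] by (simp add: ennreal_mult[symmetric])
  finally show ?thesis
    by (intro prob_spaceI) simp
qed

lemma AE_gamma_law_pos:
  assumes "a > 0"
  shows "AE x in gamma_law a. 0 < x"
proof -
  have "gamma_law a = density lborel (\<lambda>x. ennreal (if 0 < x then x powr (a - 1) * exp (- x) / Gamma a else 0))"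
    using assms by (simp add: gamma_law_def)
  then show ?thesis
    by (simp only:, subst AE_density) (auto intro!: AE_I2 split: if_splits)
qed

lemma AE_gamma_law_nonneg:
  assumes "a \<ge> 0"
  shows "AE x in gamma_law a. 0 \<le> x"
proof (cases "a = 0")
  case True
  then have "gamma_law a = return borel 0" by (simp add: gamma_law_def)
  then show ?thesis by (simp only:, subst AE_return) auto
next
  case False
  with assms have "AE x in gamma_law a. 0 < x"
    by (intro AE_gamma_law_pos) auto
  then show ?thesis by (rule AE_mp) (auto intro!: AE_I2)
qed

text \<open>
  Rescaling a gamma variable by \<open>u\<close> only changes its density by an exponential factor. For
  \<open>a = 0\<close> both sides are the value at \<open>0\<close>, which the rescaling fixes.
\<close>

lemma nn_integral_gamma_law_scale:
  assumes "a \<ge> 0" "u > 0" and [measurable]: "f \<in> borel_measurable borel"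
  shows "(\<integral>\<^sup>+x. f x \<partial>gamma_law a) =
    ennreal (u powr a) * (\<integral>\<^sup>+y. f (u * y) * ennreal (exp (y - u * y)) \<partial>gamma_law a)"
proof (cases "a = 0")
  case True
  then show ?thesis using assms by (simp add: gamma_law_def nn_integral_return)
next
  case False
  with assms have a: "a > 0" by simp
  let ?d = "\<lambda>x. ennreal (if 0 < x then x powr (a - 1) * exp (- x) / Gamma a else 0)"
  have *: "ennreal u * (?d (u * y) * f (u * y)) =
      ennreal (u powr a) * (?d y * (f (u * y) * ennreal (exp (y - u * y))))" for y
  proof (cases "y > 0")
    case True
    have "u * ((u * y) powr (a - 1) * exp (- (u * y)) / Gamma a) =
        u powr a * (y powr (a - 1) * exp (- y) / Gamma a) * exp (y - u * y)"
      using assms True by (simp add: powr_mult powr_diff exp_diff exp_minus field_simps)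
    then have "ennreal u * ?d (u * y) = ennreal (u powr a) * ?d y * ennreal (exp (y - u * y))"
      using assms True a by (simp add: ennreal_mult'[symmetric] zero_less_mult_iff Gamma_real_pos less_imp_le)
    then have "ennreal u * ?d (u * y) * f (u * y) = ennreal (u powr a) * ?d y * ennreal (exp (y - u * y)) * f (u * y)"
      by simp
    then show ?thesis
      by (simp add: mult_ac)
  next
    case False
    then show ?thesis using assms by (simp add: zero_less_mult_iff)
  qed
  have "(\<integral>\<^sup>+x. f x \<partial>gamma_law a) = ennreal u * (\<integral>\<^sup>+y. ?d (u * y) * f (u * y) \<partial>lborel)"
    unfolding nn_integral_gamma_law[OF a assms(3)]
    using assms(2) nn_integral_real_affine[of "\<lambda>x. ?d x * f x" u 0] by (simp cong: if_cong)
  also have "\<dots> = ennreal (u powr a) * (\<integral>\<^sup>+y. ?d y * (f (u * y) * ennreal (exp (y - u * y))) \<partial>lborel)"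
    by (simp add: nn_integral_cmult[symmetric] *)
  finally show ?thesis
    using a by (simp add: nn_integral_gamma_law)
qed

text \<open>
  The Laplace transform is the rescaling identity for the constant function \<open>1\<close> and \<open>u = 1 + x\<close>.
\<close>

lemma nn_integral_gamma_law_exp:
  assumes "a \<ge> 0" "x \<ge> 0"
  shows "(\<integral>\<^sup>+y. ennreal (exp (- (x * y))) \<partial>gamma_law a) = ennreal ((1 + x) powr (- a))"
proof -
  interpret prob_space "gamma_law a" by (rule prob_space_gamma_law[OF assms(1)])
  let ?I = "\<integral>\<^sup>+y. ennreal (exp (- (x * y))) \<partial>gamma_law a"
  have "1 = ennreal ((1 + x) powr a) * ?I"
    using nn_integral_gamma_law_scale[OF assms(1), of "1 + x" "\<lambda>_. 1"] assms(2) emeasure_space_1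
    by (simp add: algebra_simps)
  then have "ennreal ((1 + x) powr (- a)) = ennreal ((1 + x) powr (- a)) * ennreal ((1 + x) powr a) * ?I"
    by (simp add: mult.assoc)
  also have "ennreal ((1 + x) powr (- a)) * ennreal ((1 + x) powr a) = 1"
    using assms(2) by (simp add: ennreal_mult[symmetric] powr_add[symmetric])
  finally show ?thesis by simp
qed

text \<open>
  For a product the exponential factors combine into a function of the sum of the coordinates alone;
  this is what makes the normalised vector behave independently of the sum.
\<close>

lemma nn_integral_PiM_gamma_law_scale:
  fixes a :: "'i \<Rightarrow> real"
  assumes I: "finite I" and a: "\<And>i. i \<in> I \<Longrightarrow> a i \<ge> 0" and u: "u > 0"
    and f [measurable]: "f \<in> borel_measurable (\<Pi>\<^sub>M i\<in>I. borel)"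
  shows "(\<integral>\<^sup>+y. f y \<partial>(\<Pi>\<^sub>M i\<in>I. gamma_law (a i))) =
    ennreal (u powr (\<Sum>i\<in>I. a i)) *
      (\<integral>\<^sup>+y. f (\<lambda>i\<in>I. u * y i) * ennreal (exp ((\<Sum>i\<in>I. y i) - u * (\<Sum>i\<in>I. y i)))
         \<partial>(\<Pi>\<^sub>M i\<in>I. gamma_law (a i)))"
proof -
  \<comment> \<open>The product locale asks for a measure at every index, so \<open>a\<close> is made nonnegative outside \<open>I\<close>.\<close>
  define b where "b i = (if i \<in> I then a i else 0)" for i
  have PiM_eq: "(\<Pi>\<^sub>M i\<in>I. gamma_law (a i)) = (\<Pi>\<^sub>M i\<in>I. gamma_law (b i))"
    by (intro PiM_cong) (auto simp: b_def)
  have b: "b i \<ge> 0" for i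
    using a by (simp add: b_def)
  interpret product_sigma_finite "\<lambda>i. gamma_law (b i)"
    by (intro product_sigma_finite.intro prob_space_imp_sigma_finite prob_space_gamma_law b)
  let ?Q = "\<Pi>\<^sub>M i\<in>I. gamma_law (b i)"
  have sets_Q [measurable_cong]: "sets ?Q = sets (\<Pi>\<^sub>M i\<in>I. borel)"
    by (intro sets_PiM_cong) auto
  let ?t = "\<lambda>y. \<lambda>i\<in>I. u * y i :: real"
  let ?w = "\<lambda>y. ennreal (u powr (\<Sum>i\<in>I. a i) * exp ((\<Sum>i\<in>I. y i) - u * (\<Sum>i\<in>I. y i)))"
  have [measurable]: "?t \<in> ?Q \<rightarrow>\<^sub>M (\<Pi>\<^sub>M i\<in>I. borel)"
    by measurable
  have "distr (density ?Q ?w) (\<Pi>\<^sub>M i\<in>I. borel) ?t = ?Q"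
  proof (rule PiM_eqI[OF I])
    fix A assume A: "\<And>i. i \<in> I \<Longrightarrow> A i \<in> sets (gamma_law (b i))"
    then have [measurable]: "Pi\<^sub>E I A \<in> sets (\<Pi>\<^sub>M i\<in>I. borel)"
      by (intro sets_PiM_I_finite I) auto
    have "emeasure (distr (density ?Q ?w) (\<Pi>\<^sub>M i\<in>I. borel) ?t) (Pi\<^sub>E I A)
        = (\<integral>\<^sup>+y. indicator (Pi\<^sub>E I A) y \<partial>distr (density ?Q ?w) (\<Pi>\<^sub>M i\<in>I. borel) ?t)"
      by simp
    also have "\<dots> = (\<integral>\<^sup>+y. indicator (Pi\<^sub>E I A) (?t y) \<partial>density ?Q ?w)"
      by (rule nn_integral_distr) measurable
    also have "\<dots> = (\<integral>\<^sup>+y. ?w y * indicator (Pi\<^sub>E I A) (?t y) \<partial>?Q)"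
      by (rule nn_integral_density) measurable
    also have "\<dots> = (\<integral>\<^sup>+y. (\<Prod>i\<in>I. ennreal (u powr a i) *
        (indicator (A i) (u * y i) * ennreal (exp (y i - u * y i)))) \<partial>?Q)"
    proof (intro nn_integral_cong)
      fix y
      have "?w y = (\<Prod>i\<in>I. ennreal (u powr a i)) * (\<Prod>i\<in>I. ennreal (exp (y i - u * y i)))"
        using u I by (simp add: ennreal_mult powr_sum exp_sum prod_ennreal prod_nonneg sum_distrib_left sum_subtractf[symmetric])
      moreover have "indicator (Pi\<^sub>E I A) (?t y) = (\<Prod>i\<in>I. indicator (A i) (u * y i) :: ennreal)"
        using I by (auto simp: indicator_def PiE_iff prod_zero_iff)
      ultimately show "?w y * indicator (Pi\<^sub>E I A) (?t y) = (\<Prod>i\<in>I. ennreal (u powr a i) *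
        (indicator (A i) (u * y i) * ennreal (exp (y i - u * y i))))"
        by (simp add: prod.distrib mult_ac)
    qed
    also have "\<dots> = (\<Prod>i\<in>I. ennreal (u powr a i) * 
        (\<integral>\<^sup>+y. indicator (A i) (u * y) * ennreal (exp (y - u * y)) \<partial>gamma_law (b i)))"
      using A by (subst product_nn_integral_prod[OF I]) (auto intro!: prod.cong nn_integral_cmult)
    also have "\<dots> = (\<Prod>i\<in>I. emeasure (gamma_law (b i)) (A i))"
    proof (intro prod.cong refl)
      fix i assume i: "i \<in> I"
      show "ennreal (u powr a i) * (\<integral>\<^sup>+y. indicator (A i) (u * y) * ennreal (exp (y - u * y)) \<partial>gamma_law (b i))
        = emeasure (gamma_law (b i)) (A i)"
        using nn_integral_gamma_law_scale[OF b u, of "indicator (A i)" i] A[OF i] i by (simp add: b_def)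
    qed
    finally show "emeasure (distr (density ?Q ?w) (\<Pi>\<^sub>M i\<in>I. borel) ?t) (Pi\<^sub>E I A) = \<dots>" .
  qed (simp add: sets_Q)
  then have "(\<integral>\<^sup>+y. f y \<partial>?Q) = (\<integral>\<^sup>+y. f y \<partial>distr (density ?Q ?w) (\<Pi>\<^sub>M i\<in>I. borel) ?t)"
    by simp
  also have "\<dots> = (\<integral>\<^sup>+y. ?w y * f (?t y) \<partial>?Q)"
    by (simp add: nn_integral_distr nn_integral_density)
  also have "\<dots> = (\<integral>\<^sup>+y. ennreal (u powr (\<Sum>i\<in>I. a i)) * (f (?t y) * ennreal (exp ((\<Sum>i\<in>I. y i) - u * (\<Sum>i\<in>I. y i)))) \<partial>?Q)"
    by (simp add: ennreal_mult mult_ac)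
  also have "\<dots> = ennreal (u powr (\<Sum>i\<in>I. a i)) *
     (\<integral>\<^sup>+y. (f (?t y) * ennreal (exp ((\<Sum>i\<in>I. y i) - u * (\<Sum>i\<in>I. y i)))) \<partial>?Q)"
    by (rule nn_integral_cmult) measurable
  finally show ?thesis
    unfolding PiM_eq .
qed

section \<open>The Stieltjes transform of a Dirichlet vector\<close>

text \<open>
  Let \<open>y\<close> be the vector of independent gammas, \<open>S\<close> its sum and \<open>A = (\<Sum>i. r i * y i)\<close>. The left side is the
  expectation of \<open>(1 + A / S) powr (- \<theta>)\<close>, and \<open>(1 + A / S) powr (- \<theta>)\<close> is the Laplace transform of a
  gamma variable \<open>v\<close> at \<open>A / S\<close>. Substituting \<open>v = u * S\<close>, rescaling \<open>y\<close> by \<open>u\<close> inside the double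
  integral, and finally substituting \<open>u = S * w\<close> separates the integral into \<open>E exp (- A)\<close>, which is the
  product on the right, and a constant \<open>K\<close> independent of \<open>r\<close>.
\<close>

lemma dirichlet_law_Stieltjes_transform:
  fixes a r :: "'i \<Rightarrow> real"
  assumes I: "finite I" and a: "\<And>i. i \<in> I \<Longrightarrow> a i \<ge> 0" and r: "\<And>i. i \<in> I \<Longrightarrow> r i \<ge> 0"
    and \<theta>: "\<theta> = (\<Sum>i\<in>I. a i)" "\<theta> > 0"
  shows "(\<integral>\<^sup>+z. ennreal ((1 + (\<Sum>i\<in>I. r i * z i)) powr (- \<theta>)) \<partial>dirichlet_law I a) =
    ennreal (\<Prod>i\<in>I. (1 + r i) powr (- a i))"
proof -
  \<comment> \<open>The product locale asks for a measure at every index, so \<open>a\<close> is made nonnegative outside \<open>I\<close>.\<close>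
  define b where "b i = (if i \<in> I then a i else 0)" for i
  have b: "b i \<ge> 0" for i
    using a by (simp add: b_def)
  interpret product_prob_space "\<lambda>i. gamma_law (b i)"
    by (intro product_prob_spaceI prob_space_gamma_law b)
  define Q where "Q = (\<Pi>\<^sub>M i\<in>I. gamma_law (a i))"
  have Q_b: "Q = (\<Pi>\<^sub>M i\<in>I. gamma_law (b i))"
    unfolding Q_def by (intro PiM_cong) (auto simp: b_def)
  have sets_Q [measurable_cong]: "sets Q = sets (\<Pi>\<^sub>M i\<in>I. borel)"
    unfolding Q_def by (intro sets_PiM_cong) auto
  interpret Q: prob_space Q
    unfolding Q_def by (intro prob_space_PiM prob_space_gamma_law a)
  define S where "S y = (\<Sum>i\<in>I. y i)" for y :: "'i \<Rightarrow> real"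
  define A where "A r y = (\<Sum>i\<in>I. r i * y i)" for r y :: "'i \<Rightarrow> real"
  have [measurable]: "S \<in> borel_measurable Q" "A r \<in> borel_measurable Q" for r
    unfolding S_def A_def by measurable

  have y_nonneg: "AE y in Q. \<forall>i\<in>I. 0 \<le> y i"
    unfolding Q_def
    by (intro AE_finite_allI I AE_PiM_component prob_space_gamma_law AE_gamma_law_nonneg) (use a in auto)
  obtain j where j: "j \<in> I" "a j > 0"
    using \<theta> sum_nonpos[of I a] by (meson not_less)
  have "AE y in Q. 0 < y j"
    unfolding Q_def
    by (intro AE_PiM_component prob_space_gamma_law AE_gamma_law_pos) (use a j in auto)
  with y_nonneg have S_pos: "AE y in Q. (\<forall>i\<in>I. 0 \<le> y i) \<and> 0 < S y"
  proof eventually_elim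
    case (elim y)
    have "y j \<le> S y"
      unfolding S_def using elim I j by (intro member_le_sum) auto
    with elim show ?case by auto
  qed

  \<comment> \<open>The integrand is the inverse gamma density; the case \<open>r = 0\<close> of the identity below
    shows that \<open>K = 1\<close>.\<close>
  define K where "K = (\<integral>\<^sup>+u. ennreal (if 0 < u then u powr (- \<theta> - 1) * exp (- (1 / u)) / Gamma \<theta> else 0) \<partial>lborel)"
  interpret LQ: pair_sigma_finite lborel Q
    by (intro pair_sigma_finite.intro lborel.sigma_finite_measure_axioms Q.sigma_finite_measure_axioms)
  have Gpos: "Gamma \<theta> > 0"
    using \<theta>(2) by (rule Gamma_real_pos)

  have key: "(\<integral>\<^sup>+y. ennreal ((1 + A r y / S y) powr (- \<theta>)) \<partial>Q) = (\<integral>\<^sup>+y. ennreal (exp (- A r y)) \<partial>Q) * K"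
    if r: "\<And>i. i \<in> I \<Longrightarrow> r i \<ge> 0" for r
  proof -
    let ?f = "\<lambda>u y. ennreal (if 0 < u then u powr (\<theta> - 1) * S y powr \<theta> * exp (- (u * S y) - u * A r y) / Gamma \<theta> else 0)"
    let ?g = "\<lambda>u y. ennreal (if 0 < u then u powr (- \<theta> - 1) * S y powr \<theta> * exp (- (S y / u) - A r y) / Gamma \<theta> else 0)"
    \<comment> \<open>The gamma integral for the inner factor, with \<open>v = u * S y\<close>.\<close>
    have "(\<integral>\<^sup>+y. ennreal ((1 + A r y / S y) powr (- \<theta>)) \<partial>Q) = (\<integral>\<^sup>+y. (\<integral>\<^sup>+u. ?f u y \<partial>lborel) \<partial>Q)"
    proof (rule nn_integral_cong_AE, use S_pos in eventually_elim)
      case (elim y)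
      let ?d = "\<lambda>x. ennreal (if 0 < x then x powr (\<theta> - 1) * exp (- x) / Gamma \<theta> else 0)"
      have A0: "A r y \<ge> 0"
        unfolding A_def using elim r by (intro sum_nonneg mult_nonneg_nonneg) auto
      have "ennreal ((1 + A r y / S y) powr (- \<theta>)) = (\<integral>\<^sup>+v. ennreal (exp (- (A r y / S y * v))) \<partial>gamma_law \<theta>)"
        using nn_integral_gamma_law_exp[of \<theta> "A r y / S y"] elim A0 \<theta>(2) by simp
      also have "\<dots> = (\<integral>\<^sup>+v. ?d v * ennreal (exp (- (A r y / S y * v))) \<partial>lborel)"
        using \<theta>(2) by (simp add: nn_integral_gamma_law)
      also have "\<dots> = ennreal (S y) * (\<integral>\<^sup>+u. ?d (S y * u) * ennreal (exp (- (A r y / S y * (S y * u)))) \<partial>lborel)"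
        using nn_integral_real_affine[of "\<lambda>v. ?d v * ennreal (exp (- (A r y / S y * v)))" "S y" 0] elim
        by (simp cong: if_cong)
      also have "\<dots> = (\<integral>\<^sup>+u. ennreal (S y) * (?d (S y * u) * ennreal (exp (- (A r y / S y * (S y * u))))) \<partial>lborel)"
        by (rule nn_integral_cmult[symmetric]) measurable
      also have "\<dots> = (\<integral>\<^sup>+u. ?f u y \<partial>lborel)"
      proof (intro nn_integral_cong)
        fix u :: real
        show "ennreal (S y) * (?d (S y * u) * ennreal (exp (- (A r y / S y * (S y * u))))) = ?f u y"
        proof (cases "u > 0")
          case True
          have "S y * ((S y * u) powr (\<theta> - 1) * exp (- (S y * u)) / Gamma \<theta> * exp (- (A r y / S y * (S y * u))))
             = u powr (\<theta> - 1) * S y powr \<theta> * exp (- (u * S y) - u * A r y) / Gamma \<theta>"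
            using elim True Gpos
            by (simp add: powr_mult powr_diff exp_diff exp_minus field_simps)
          then show ?thesis
            using elim True Gpos by (simp add: ennreal_mult'[symmetric] zero_less_mult_iff less_imp_le)
        next
          case False
          then show ?thesis using elim by (simp add: zero_less_mult_iff)
        qed
      qed
      finally show ?case .
    qed
    also have "\<dots> = (\<integral>\<^sup>+u. (\<integral>\<^sup>+y. ?f u y \<partial>Q) \<partial>lborel)"
      by (rule LQ.Fubini') measurable
    \<comment> \<open>For fixed \<open>u\<close> the vector \<open>y\<close> is rescaled by \<open>u\<close>, which removes \<open>u\<close> from the factor \<open>exp (- u * A r y)\<close>.\<close>
    also have "\<dots> = (\<integral>\<^sup>+u. (\<integral>\<^sup>+y. ?g u y \<partial>Q) \<partial>lborel)"
    proof (rule nn_integral_cong)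
      fix u :: real
      show "(\<integral>\<^sup>+y. ?f u y \<partial>Q) = (\<integral>\<^sup>+y. ?g u y \<partial>Q)"
      proof (cases "u > 0")
        case u: True
        have g_meas: "?g u \<in> borel_measurable (\<Pi>\<^sub>M i\<in>I. borel)"
          unfolding measurable_cong_sets[OF sets_Q refl, symmetric] by measurable
        have [simp]: "S (\<lambda>i\<in>I. u * y i) = u * S y" "A r (\<lambda>i\<in>I. u * y i) = u * A r y" for y
          by (simp_all add: S_def A_def sum_distrib_left mult_ac)
        have "(\<integral>\<^sup>+y. ?g u y \<partial>Q) = ennreal (u powr \<theta>) *
            (\<integral>\<^sup>+y. ?g u (\<lambda>i\<in>I. u * y i) * ennreal (exp (S y - u * S y)) \<partial>Q)"
          using nn_integral_PiM_gamma_law_scale[of I a, OF I a u g_meas]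
          unfolding Q_def[symmetric] unfolding \<theta>(1)[symmetric] unfolding S_def[symmetric] .
        also have "\<dots> = (\<integral>\<^sup>+y. ennreal (u powr \<theta>) * (?g u (\<lambda>i\<in>I. u * y i) * ennreal (exp (S y - u * S y))) \<partial>Q)"
          by (rule nn_integral_cmult[symmetric]) (simp, measurable)
        also have "\<dots> = (\<integral>\<^sup>+y. ?f u y \<partial>Q)"
        proof (rule nn_integral_cong_AE, use S_pos in eventually_elim)
          case (elim y)
          have "u powr \<theta> * (u powr (- \<theta> - 1) * (u * S y) powr \<theta> * exp (- (u * S y / u) - u * A r y) / Gamma \<theta> * exp (S y - u * S y))
            = u powr (\<theta> - 1) * S y powr \<theta> * exp (- (u * S y) - u * A r y) / Gamma \<theta>"
            using elim u Gpos by (simp add: powr_mult powr_diff powr_minus exp_diff exp_minus field_simps)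
          then show ?case
            using elim u Gpos by (simp add: ennreal_mult'[symmetric] less_imp_le)
        qed
        finally show ?thesis ..
      qed simp
    qed
    also have "\<dots> = (\<integral>\<^sup>+y. (\<integral>\<^sup>+u. ?g u y \<partial>lborel) \<partial>Q)"
      by (rule LQ.Fubini'[symmetric]) measurable
    \<comment> \<open>With \<open>u = S y * w\<close> the powers of \<open>S y\<close> cancel.\<close>
    also have "\<dots> = (\<integral>\<^sup>+y. ennreal (exp (- A r y)) * K \<partial>Q)"
    proof (rule nn_integral_cong_AE, use S_pos in eventually_elim)
      case (elim y)
      have "(\<integral>\<^sup>+u. ?g u y \<partial>lborel) = ennreal (S y) * (\<integral>\<^sup>+w. ?g (S y * w) y \<partial>lborel)"
        using nn_integral_real_affine[of "\<lambda>u. ?g u y" "S y" 0] elim by (simp cong: if_cong)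
      also have "\<dots> = (\<integral>\<^sup>+w. ennreal (S y) * ?g (S y * w) y \<partial>lborel)"
        by (rule nn_integral_cmult[symmetric]) measurable
      also have "\<dots> = (\<integral>\<^sup>+w. ennreal (exp (- A r y)) *
          ennreal (if 0 < w then w powr (- \<theta> - 1) * exp (- (1 / w)) / Gamma \<theta> else 0) \<partial>lborel)"
      proof (intro nn_integral_cong)
        fix w :: real
        show "ennreal (S y) * ?g (S y * w) y = ennreal (exp (- A r y)) *
            ennreal (if 0 < w then w powr (- \<theta> - 1) * exp (- (1 / w)) / Gamma \<theta> else 0)"
        proof (cases "w > 0")
          case True
          have "S y / (S y * w) = 1 / w"
            using elim by simp
          then have "S y * ((S y * w) powr (- \<theta> - 1) * S y powr \<theta> * exp (- (S y / (S y * w)) - A r y) / Gamma \<theta>)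
              = exp (- A r y) * (w powr (- \<theta> - 1) * exp (- (1 / w)) / Gamma \<theta>)"
            using elim True Gpos
            by (simp only: exp_diff) (simp add: powr_mult powr_diff powr_minus exp_minus divide_simps)
          then show ?thesis
            using elim True Gpos by (simp add: ennreal_mult'[symmetric] zero_less_mult_iff less_imp_le)
        next
          case False
          then show ?thesis using elim by (simp add: zero_less_mult_iff)
        qed
      qed
      also have "\<dots> = ennreal (exp (- A r y)) * K"
        unfolding K_def by (rule nn_integral_cmult) measurable
      finally show ?case .
    qed
    also have "\<dots> = (\<integral>\<^sup>+y. ennreal (exp (- A r y)) \<partial>Q) * K"
      by (rule nn_integral_multc) measurable
    finally show ?thesis .
  qed
  have "K = 1"
    using key[of "\<lambda>_. 0"] by (simp add: A_def Q.emeasure_space_1)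
  have "(\<integral>\<^sup>+z. ennreal ((1 + (\<Sum>i\<in>I. r i * z i)) powr (- \<theta>)) \<partial>dirichlet_law I a)
      = (\<integral>\<^sup>+y. ennreal ((1 + A r y / S y) powr (- \<theta>)) \<partial>Q)"
    unfolding dirichlet_law_def Q_def[symmetric]
    by (subst nn_integral_distr) (auto simp: A_def S_def sum_divide_distrib cong: sum.cong)
  also have "\<dots> = (\<integral>\<^sup>+y. ennreal (exp (- A r y)) \<partial>Q)"
    using key[OF r] \<open>K = 1\<close> by simp
  also have "\<dots> = (\<integral>\<^sup>+y. (\<Prod>i\<in>I. ennreal (exp (- (r i * y i)))) \<partial>Q)"
    using I by (simp add: A_def exp_sum prod_ennreal sum_negf[symmetric])
  also have "\<dots> = (\<Prod>i\<in>I. \<integral>\<^sup>+y. ennreal (exp (- (r i * y))) \<partial>gamma_law (b i))"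
    unfolding Q_b
    using product_nn_integral_prod[OF I, of "\<lambda>i y. ennreal (exp (- (r i * y)))"] by simp
  also have "\<dots> = (\<Prod>i\<in>I. ennreal ((1 + r i) powr (- a i)))"
    using r a by (intro prod.cong) (auto simp: nn_integral_gamma_law_exp b_def)
  also have "\<dots> = ennreal (\<Prod>i\<in>I. (1 + r i) powr (- a i))"
    by (simp add: prod_ennreal)
  finally show ?thesis .
qed

section \<open>The Markov-Krein identity for Dirichlet processes\<close>

lemma integral_finite_partition:
  fixes r :: "nat \<Rightarrow> real"
  assumes "prob_space N" "sets N = sets F" and C: "\<And>i. i < k \<Longrightarrow> C i \<in> sets F"
    and h: "\<And>x. x \<in> space F \<Longrightarrow> h x = (\<Sum>i<k. r i * indicator (C i) x)"
  shows "(\<integral>x. h x \<partial>N) = (\<Sum>i<k. r i * measure N (C i))"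
proof -
  interpret N: prob_space N by fact
  have sp: "space N = space F"
    using assms(2) by (rule sets_eq_imp_space_eq)
  have C': "i < k \<Longrightarrow> C i \<in> sets N" for i
    using C assms(2) by simp
  have int: "i < k \<Longrightarrow> integrable N (\<lambda>x. r i * indicator (C i) x)" for i
    using C'[of i] by (intro integrable_mult_right) (simp add: N.emeasure_eq_measure)
  have "(\<integral>x. h x \<partial>N) = (\<integral>x. (\<Sum>i<k. r i * indicator (C i) x) \<partial>N)"
    using h by (intro Bochner_Integration.integral_cong) (auto simp: sp)
  also have "\<dots> = (\<Sum>i<k. \<integral>x. r i * indicator (C i) x \<partial>N)"
    using int by (intro Bochner_Integration.integral_sum) auto
  also have "\<dots> = (\<Sum>i<k. r i * measure N (C i))"
    using C' sets.sets_into_space[OF C'] by (intro sum.cong) (auto simp: Int_absorb1 Int_absorb2)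
  finally show "(\<integral>x. h x \<partial>N) = (\<Sum>i<k. r i * measure N (C i))" .
qed

lemma dirichlet_process_kernel:
  assumes "dirichlet_process W \<theta> F P" "\<omega> \<in> space W"
  shows "prob_space (P \<omega>)" "sets (P \<omega>) = sets F" "space (P \<omega>) = space F"
proof -
  have "P \<omega> \<in> space (prob_algebra F)"
    using assms by (auto simp: dirichlet_process_def dest: measurable_space)
  then show "prob_space (P \<omega>)" "sets (P \<omega>) = sets F"
    by (auto simp: space_prob_algebra)
  then show "space (P \<omega>) = space F"
    using sets_eq_imp_space_eq by blast
qed

lemma dirichlet_process_kernel_measurable:
  assumes "dirichlet_process W \<theta> F P" "\<omega> \<in> space W" "f \<in> F \<rightarrow>\<^sub>M K"
  shows "f \<in> P \<omega> \<rightarrow>\<^sub>M K"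
  using assms(3) measurable_cong_sets[OF dirichlet_process_kernel(2)[OF assms(1,2)] refl] by auto

lemma dirichlet_process_measurable:
  assumes "dirichlet_process W \<theta> F P"
  shows "P \<in> W \<rightarrow>\<^sub>M subprob_algebra F"
  using assms by (auto simp: dirichlet_process_def intro: measurable_prob_algebraD)

text \<open>
  The level sets of a simple function form a finite partition, on which the process has a Dirichlet
  distributed vector of masses; the integral of \<open>h\<close> is a linear form of that vector.
\<close>

lemma Markov_Krein_simple_function:
  fixes h :: "'a \<Rightarrow> real"
  assumes DP: "dirichlet_process W \<theta> F P" and F: "prob_space F" and \<theta>: "\<theta> > 0"
    and h: "simple_function F h" and nn: "\<And>x. x \<in> space F \<Longrightarrow> 0 \<le> h x"
  shows "(\<integral>\<omega>. (1 + (\<integral>x. h x \<partial>P \<omega>)) powr (- \<theta>) \<partial>W) = exp (- \<theta> * (\<integral>x. ln (1 + h x) \<partial>F))"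
proof -
  interpret F: prob_space F by fact
  define k where "k = card (h ` space F)"
  have "finite (h ` space F)"
    using h by (rule simple_functionD)
  then obtain r where r: "bij_betw r {..<k} (h ` space F)"
    unfolding k_def atLeast0LessThan[symmetric] using ex_bij_betw_nat_finite by blast
  define C where "C i = h -` {r i} \<inter> space F" for i
  have C [measurable]: "C i \<in> sets F" for i
    unfolding C_def using h by (rule simple_functionD)
  have disj: "disjoint_family_on C {..<k}"
    using r by (auto simp: disjoint_family_on_def C_def bij_betw_def inj_on_def)
  have un: "(\<Union>i<k. C i) = space F"
    using r by (auto simp: C_def bij_betw_def image_iff set_eq_iff)
  have sum: "\<phi> (h x) = (\<Sum>i<k. \<phi> (r i) * indicator (C i) x)" if x: "x \<in> space F" for \<phi> :: "real \<Rightarrow> real" and x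
  proof -
    obtain j where j: "j < k" "x \<in> C j"
      using un x by blast
    have "(\<Sum>i<k. \<phi> (r i) * indicator (C i) x) = (\<Sum>i<k. if i = j then \<phi> (r i) else 0)"
      using j disj by (intro sum.cong) (auto simp: indicator_def disjoint_family_on_def)
    also have "\<dots> = \<phi> (h x)"
      using j by (simp add: C_def)
    finally show ?thesis ..
  qed
  have r_nn: "r i \<ge> 0" if "i < k" for i
  proof -
    have "r i \<in> h ` space F"
      using r that by (auto dest: bij_betwE)
    then show ?thesis
      using nn by auto
  qed
  have meas_sum: "(\<Sum>i<k. \<theta> * measure F (C i)) = \<theta>"
    using F.finite_measure_finite_Union[of "{..<k}" C] disj un
    by (simp add: sum_distrib_left[symmetric] F.prob_space image_subset_iff)
  let ?V = "\<lambda>\<omega>. \<lambda>i\<in>{..<k}. measure (P \<omega>) (C i)"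
  have P [measurable]: "P \<in> W \<rightarrow>\<^sub>M subprob_algebra F"
    using DP by (rule dirichlet_process_measurable)
  have mean: "(\<integral>x. h x \<partial>P \<omega>) = (\<Sum>i<k. r i * measure (P \<omega>) (C i))" if "\<omega> \<in> space W" for \<omega>
    using dirichlet_process_kernel(1,2)[OF DP that] C sum[of _ "\<lambda>x. x"] by (rule integral_finite_partition)
  have V: "?V \<in> W \<rightarrow>\<^sub>M (\<Pi>\<^sub>M i\<in>{..<k}. borel)"
    by (intro measurable_restrict measurable_compose[OF P]) simp
  have distr: "distr W (\<Pi>\<^sub>M i\<in>{..<k}. borel) ?V = dirichlet_law {..<k} (\<lambda>i. \<theta> * measure F (C i))"
    using DP C disj un by (auto simp: dirichlet_process_def)
  have "(\<integral>\<^sup>+\<omega>. ennreal ((1 + (\<integral>x. h x \<partial>P \<omega>)) powr (- \<theta>)) \<partial>W) =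
      (\<integral>\<^sup>+\<omega>. ennreal ((1 + (\<Sum>i<k. r i * ?V \<omega> i)) powr (- \<theta>)) \<partial>W)"
    by (intro nn_integral_cong) (simp add: mean)
  also have "\<dots> = (\<integral>\<^sup>+z. ennreal ((1 + (\<Sum>i<k. r i * z i)) powr (- \<theta>)) \<partial>distr W (\<Pi>\<^sub>M i\<in>{..<k}. borel) ?V)"
    using V by (subst nn_integral_distr) auto
  also have "\<dots> = ennreal (\<Prod>i<k. (1 + r i) powr (- (\<theta> * measure F (C i))))"
    unfolding distr using \<theta> r_nn meas_sum by (intro dirichlet_law_Stieltjes_transform) auto
  also have "(\<Prod>i<k. (1 + r i) powr (- (\<theta> * measure F (C i)))) = (\<Prod>i<k. exp (- \<theta> * (ln (1 + r i) * measure F (C i))))"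
    using r_nn by (intro prod.cong) (auto simp: powr_def add_nonneg_eq_0_iff)
  also have "\<dots> = exp (- \<theta> * (\<Sum>i<k. ln (1 + r i) * measure F (C i)))"
    by (simp add: exp_sum[symmetric] sum_distrib_left)
  also have "(\<Sum>i<k. ln (1 + r i) * measure F (C i)) = (\<integral>x. ln (1 + h x) \<partial>F)"
    using sum[of _ "\<lambda>y. ln (1 + y)"] by (intro integral_finite_partition[symmetric, OF F refl C]) auto
  finally have nn: "(\<integral>\<^sup>+\<omega>. ennreal ((1 + (\<integral>x. h x \<partial>P \<omega>)) powr (- \<theta>)) \<partial>W) = ennreal (exp (- \<theta> * (\<integral>x. ln (1 + h x) \<partial>F)))" .
  have [measurable]: "h \<in> borel_measurable F"
    using h by (rule borel_measurable_simple_function)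
  have [measurable]: "(\<lambda>\<omega>. \<integral>x. h x \<partial>P \<omega>) \<in> borel_measurable W"
    by (rule measurable_compose[OF P]) measurable
  show ?thesis
    by (subst integral_eq_nn_integral) (simp_all add: nn)
qed

text \<open>
  Simple functions \<open>u n\<close> increasing to \<open>h\<close> give the identity with the extended nonnegative integral \<open>N\<close> of
  \<open>h\<close>, where \<open>(1 + l * \<infinity>) powr (- \<theta>)\<close> is read as \<open>0\<close>. As \<open>l\<close> tends to \<open>0\<close> the left side tends to the
  probability that \<open>N\<close> is finite and the right side to \<open>1\<close>. Hence the random integral is finite almost
  surely and coincides with the Bochner integral.
\<close>

theorem Markov_Krein:
  fixes h :: "'a \<Rightarrow> real"
  assumes DP: "dirichlet_process W \<theta> F P" and F: "prob_space F" and \<theta>: "\<theta> > 0"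
    and h [measurable]: "h \<in> borel_measurable F" and nn: "\<And>x. x \<in> space F \<Longrightarrow> 0 \<le> h x"
    and int: "\<And>l. l > 0 \<Longrightarrow> integrable F (\<lambda>x. ln (1 + l * h x))"
  shows "AE \<omega> in W. integrable (P \<omega>) h"
    and "l \<ge> 0 \<Longrightarrow> (\<integral>\<omega>. (1 + l * (\<integral>x. h x \<partial>P \<omega>)) powr (- \<theta>) \<partial>W) = exp (- \<theta> * (\<integral>x. ln (1 + l * h x) \<partial>F))"
proof -
  interpret F: prob_space F by fact
  interpret W: prob_space W using DP by (simp add: dirichlet_process_def)
  note kernel = dirichlet_process_kernel[OF DP]
  have P [measurable]: "P \<in> W \<rightarrow>\<^sub>M subprob_algebra F"
    using DP by (rule dirichlet_process_measurable)
  obtain U where U: "\<And>i. simple_function F (U i)" "incseq U" "\<And>i x. U i x < top" "\<And>x. (SUP i. U i x) = ennreal (h x)"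
    by (rule borel_measurable_implies_simple_function_sequence'[of "\<lambda>x. ennreal (h x)" F]) auto
  define u where "u n x = enn2real (U n x)" for n x
  have u_simple: "simple_function F (u n)" for n
    unfolding u_def[abs_def] by (rule simple_function_compose1[OF U(1)])
  have U_meas [measurable]: "U n \<in> borel_measurable F" for n
    using U(1) by (rule borel_measurable_simple_function)
  have u_meas [measurable]: "u n \<in> borel_measurable F" for n
    using u_simple by (rule borel_measurable_simple_function)
  have Uu: "U n x = ennreal (u n x)" for n x
    using U(3)[of n x] by (simp add: u_def)
  have u_nn: "u n x \<ge> 0" for n x
    by (simp add: u_def)
  have u_le: "u n x \<le> h x" if "x \<in> space F" for n x
  proof -
    have "ennreal (u n x) \<le> ennreal (h x)"
      unfolding Uu[symmetric] U(4)[symmetric] by (rule SUP_upper) simp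
    then show ?thesis
      using nn[OF that] by (simp add: ennreal_le_iff)
  qed
  have incU: "incseq (\<lambda>n. U n x)" for x
    using U(2) by (auto simp: incseq_def le_fun_def)
  have u_lim: "(\<lambda>n. u n x) \<longlonglongrightarrow> h x" if "x \<in> space F" for x
  proof -
    have "(\<lambda>n. U n x) \<longlonglongrightarrow> ennreal (h x)"
      using LIMSEQ_SUP[OF incU] unfolding U(4) .
    then show ?thesis
      unfolding Uu by (rule tendsto_ennrealD) (use u_nn nn that in auto)
  qed
  define N where "N \<omega> = (\<integral>\<^sup>+x. ennreal (h x) \<partial>P \<omega>)" for \<omega>
  have [measurable]: "N \<in> borel_measurable W"
    unfolding N_def[abs_def] by (rule measurable_compose[OF P]) measurable
  define m where "m n \<omega> = (\<integral>x. u n x \<partial>P \<omega>)" for n \<omega>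
  have [measurable]: "m n \<in> borel_measurable W" for n
    unfolding m_def[abs_def] by (rule measurable_compose[OF P]) measurable
  have m_nn: "m n \<omega> \<ge> 0" for n \<omega>
    unfolding m_def using u_nn by simp
  have m_lim: "(\<lambda>n. ennreal (m n \<omega>)) \<longlonglongrightarrow> N \<omega>" if \<omega>: "\<omega> \<in> space W" for \<omega>
  proof -
    interpret P: prob_space "P \<omega>" by (rule kernel[OF \<omega>])
    have "ennreal (m n \<omega>) = (\<integral>\<^sup>+x. U n x \<partial>P \<omega>)" for n
    proof -
      have "finite (u n ` space F)"
        using u_simple by (rule simple_functionD)
      from finite_imp_bounded[OF this] obtain B where "\<forall>y\<in>u n ` space F. norm y \<le> B"
        unfolding bounded_iff by blast
      moreover have "u n \<in> borel_measurable (P \<omega>)"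
        by (rule dirichlet_process_kernel_measurable[OF DP \<omega> u_meas])
      ultimately have "integrable (P \<omega>) (u n)"
        by (intro P.integrable_const_bound[of _ B]) (auto simp: kernel(3)[OF \<omega>])
      then show ?thesis
        unfolding m_def Uu using u_nn by (intro nn_integral_eq_integral[symmetric]) auto
    qed
    moreover have "N \<omega> = (SUP n. \<integral>\<^sup>+x. U n x \<partial>P \<omega>)"
      unfolding N_def U(4)[symmetric] by (rule nn_integral_monotone_convergence_SUP[OF U(2)])
        (rule dirichlet_process_kernel_measurable[OF DP \<omega> U_meas])
    moreover have "incseq (\<lambda>n. \<integral>\<^sup>+x. U n x \<partial>P \<omega>)"
      using U(2) by (auto simp: incseq_def le_fun_def intro!: nn_integral_mono)
    ultimately show ?thesis
      by (simp add: LIMSEQ_SUP)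
  qed
  \<comment> \<open>The value \<open>0\<close> at infinity makes \<open>\<phi> l\<close> continuous along sequences tending to infinity.\<close>
  define \<phi> where "\<phi> l z = (if z = top then 0 else (1 + l * enn2real z) powr (- \<theta>))" for l :: real and z :: ennreal
  have [measurable]: "\<phi> l \<in> borel_measurable borel" for l
    unfolding \<phi>_def[abs_def] by measurable
  have \<phi>_le: "norm (\<phi> l z) \<le> 1" if "l \<ge> 0" for l z
  proof -
    have "1 \<le> (1 + l * enn2real z) powr \<theta>"
      by (intro ge_one_powr_ge_zero) (use that \<theta> in auto)
    then show ?thesis
      by (simp add: \<phi>_def powr_minus inverse_le_1_iff)
  qed
  have \<phi>_ennreal: "\<phi> l (ennreal y) = (1 + l * y) powr (- \<theta>)" if "y \<ge> 0" for l y
    using that by (simp add: \<phi>_def)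
  have \<phi>_cont: "(\<lambda>n. \<phi> l (ennreal (m n \<omega>))) \<longlonglongrightarrow> \<phi> l (N \<omega>)" if \<omega>: "\<omega> \<in> space W" and l: "l > 0" for l \<omega>
  proof (cases "N \<omega> = top")
    case True
    then have "filterlim (\<lambda>n. m n \<omega>) at_top sequentially"
      using m_lim[OF \<omega>] by (simp add: ennreal_tendsto_top_eq_at_top)
    then have "filterlim (\<lambda>n. 1 + l * m n \<omega>) at_top sequentially"
      using l by (intro filterlim_tendsto_add_at_top[OF tendsto_const] filterlim_tendsto_pos_mult_at_top[OF tendsto_const])
    then have "(\<lambda>n. (1 + l * m n \<omega>) powr (- \<theta>)) \<longlonglongrightarrow> 0"
      using \<theta> by (intro tendsto_neg_powr) auto
    then show ?thesis
      using True m_nn by (simp add: \<phi>_ennreal) (simp add: \<phi>_def)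
  next
    case False
    then obtain y where y: "y \<ge> 0" "N \<omega> = ennreal y"
      by (cases "N \<omega>") auto
    have "(\<lambda>n. m n \<omega>) \<longlonglongrightarrow> y"
      using m_lim[OF \<omega>] unfolding y(2) by (rule tendsto_ennrealD) (use y m_nn in auto)
    then have "(\<lambda>n. (1 + l * m n \<omega>) powr (- \<theta>)) \<longlonglongrightarrow> (1 + l * y) powr (- \<theta>)"
      using l y(1) by (intro tendsto_intros) (auto simp: add_nonneg_eq_0_iff)
    then show ?thesis
      using y m_nn by (simp add: \<phi>_ennreal)
  qed

  have transform: "(\<integral>\<omega>. \<phi> l (N \<omega>) \<partial>W) = exp (- \<theta> * (\<integral>x. ln (1 + l * h x) \<partial>F))" if l: "l > 0" for l
  proof -
    have "(\<lambda>n. \<integral>\<omega>. \<phi> l (ennreal (m n \<omega>)) \<partial>W) \<longlonglongrightarrow> (\<integral>\<omega>. \<phi> l (N \<omega>) \<partial>W)"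
      by (rule integral_dominated_convergence[where w = "\<lambda>_. 1"]) (use \<phi>_cont l \<phi>_le in auto)
    moreover have "(\<integral>\<omega>. \<phi> l (ennreal (m n \<omega>)) \<partial>W) = exp (- \<theta> * (\<integral>x. ln (1 + l * u n x) \<partial>F))" for n
    proof -
      have "simple_function F (\<lambda>x. l * u n x)"
        using simple_function_compose1[OF u_simple, of "\<lambda>y. l * y"] .
      from Markov_Krein_simple_function[OF DP F \<theta> this] show ?thesis
        using l u_nn m_nn by (simp add: \<phi>_ennreal m_def)
    qed
    moreover have "(\<lambda>n. \<integral>x. ln (1 + l * u n x) \<partial>F) \<longlonglongrightarrow> (\<integral>x. ln (1 + l * h x) \<partial>F)"
    proof (rule integral_dominated_convergence[OF _ _ int[OF l]])
      show "AE x in F. (\<lambda>n. ln (1 + l * u n x)) \<longlonglongrightarrow> ln (1 + l * h x)"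
        using u_lim nn l by (intro AE_I2 tendsto_intros) (auto simp: add_nonneg_eq_0_iff)
      show "AE x in F. norm (ln (1 + l * u n x)) \<le> ln (1 + l * h x)" for n
      proof (rule AE_I2)
        fix x assume "x \<in> space F"
        then have "l * u n x \<le> l * h x" "0 \<le> l * u n x"
          using u_le u_nn l by simp_all
        then show "norm (ln (1 + l * u n x)) \<le> ln (1 + l * h x)"
          by simp
      qed
    qed measurable
    then have "(\<lambda>n. exp (- \<theta> * (\<integral>x. ln (1 + l * u n x) \<partial>F))) \<longlonglongrightarrow> exp (- \<theta> * (\<integral>x. ln (1 + l * h x) \<partial>F))"
      by (intro tendsto_intros)
    ultimately show ?thesis
      using LIMSEQ_unique by auto
  qed

  have finite: "AE \<omega> in W. N \<omega> < top"
  proof -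
    define l where "l n = inverse (real (Suc n))" for n
    have l: "l n > 0" "l n \<le> 1" for n
      by (auto simp: l_def field_simps)
    have l0: "l \<longlonglongrightarrow> 0"
      unfolding l_def by (rule LIMSEQ_inverse_real_of_nat)
    have lim: "(\<lambda>n. \<integral>\<omega>. \<phi> (l n) (N \<omega>) \<partial>W) \<longlonglongrightarrow> (\<integral>\<omega>. indicator {\<omega>\<in>space W. N \<omega> < top} \<omega> \<partial>W)"
    proof (rule integral_dominated_convergence[where w = "\<lambda>_. 1"])
      show "AE \<omega> in W. (\<lambda>n. \<phi> (l n) (N \<omega>)) \<longlonglongrightarrow> indicator {\<omega>\<in>space W. N \<omega> < top} \<omega>"
      proof (rule AE_I2)
        fix \<omega> assume \<omega>: "\<omega> \<in> space W"
        show "(\<lambda>n. \<phi> (l n) (N \<omega>)) \<longlonglongrightarrow> indicator {\<omega>\<in>space W. N \<omega> < top} \<omega>"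
        proof (cases "N \<omega> = top")
          case False
          have "(\<lambda>n. (1 + l n * enn2real (N \<omega>)) powr (- \<theta>)) \<longlonglongrightarrow> (1 + 0 * enn2real (N \<omega>)) powr (- \<theta>)"
            by (intro tendsto_intros l0) auto
          moreover have "N \<omega> < top"
            using False by (simp add: less_top)
          ultimately show ?thesis
            using False \<omega> by (simp add: \<phi>_def)
        qed (simp add: \<phi>_def)
      qed
    qed (use \<phi>_le l in \<open>auto simp: less_imp_le\<close>)
    have "(\<lambda>n. \<integral>x. ln (1 + l n * h x) \<partial>F) \<longlonglongrightarrow> (\<integral>x. 0 \<partial>F)"
    proof (rule integral_dominated_convergence[OF _ _ int[of 1]])
      show "AE x in F. (\<lambda>n. ln (1 + l n * h x)) \<longlonglongrightarrow> 0"
      proof (rule AE_I2)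
        fix x
        have "(\<lambda>n. ln (1 + l n * h x)) \<longlonglongrightarrow> ln (1 + 0 * h x)"
          by (intro tendsto_intros l0) auto
        then show "(\<lambda>n. ln (1 + l n * h x)) \<longlonglongrightarrow> 0" by simp
      qed
      show "AE x in F. norm (ln (1 + l n * h x)) \<le> ln (1 + 1 * h x)" for n
      proof (rule AE_I2)
        fix x assume "x \<in> space F"
        then have "l n * h x \<le> h x" "0 \<le> l n * h x"
          using nn l[of n] by (simp_all add: mult_left_le_one_le less_imp_le)
        then show "norm (ln (1 + l n * h x)) \<le> ln (1 + 1 * h x)"
          by simp
      qed
    qed simp_all
    then have "(\<lambda>n. exp (- \<theta> * (\<integral>x. ln (1 + l n * h x) \<partial>F))) \<longlonglongrightarrow> exp (- \<theta> * 0)"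
      by (intro tendsto_intros) simp
    then have "(\<lambda>n. \<integral>\<omega>. \<phi> (l n) (N \<omega>) \<partial>W) \<longlonglongrightarrow> 1"
      unfolding transform[OF l(1)] by simp
    from LIMSEQ_unique[OF lim this]
    have "(\<integral>\<omega>. indicator {\<omega>\<in>space W. N \<omega> < top} \<omega> \<partial>W) = (1 :: real)" .
    then have "measure W {\<omega>\<in>space W. N \<omega> < top} = 1"
      by (simp add: Int_absorb1)
    then show ?thesis
      by (subst (asm) W.prob_Collect_eq_1) simp_all
  qed
  have *: "AE \<omega> in W. integrable (P \<omega>) h \<and> N \<omega> = ennreal (\<integral>x. h x \<partial>P \<omega>) \<and> 0 \<le> (\<integral>x. h x \<partial>P \<omega>)"
    using finite AE_space
  proof eventually_elim
    case (elim \<omega>)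
    note [measurable] = dirichlet_process_kernel_measurable[OF DP elim(2) h]
    have AE: "AE x in P \<omega>. 0 \<le> h x"
      using nn by (intro AE_I2) (simp add: kernel(3)[OF elim(2)])
    then have "(\<integral>\<^sup>+x. ennreal (norm (h x)) \<partial>P \<omega>) = N \<omega>"
      unfolding N_def by (intro nn_integral_cong_AE) auto
    with elim have I: "integrable (P \<omega>) h"
      by (intro integrableI_bounded) auto
    with AE show ?case
      unfolding N_def by (auto simp: nn_integral_eq_integral integral_nonneg_AE)
  qed
  show "AE \<omega> in W. integrable (P \<omega>) h"
    using * by eventually_elim simp
  show "(\<integral>\<omega>. (1 + l * (\<integral>x. h x \<partial>P \<omega>)) powr (- \<theta>) \<partial>W) = exp (- \<theta> * (\<integral>x. ln (1 + l * h x) \<partial>F))" if "l \<ge> 0"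
  proof (cases "l = 0")
    case True
    then show ?thesis by (simp add: W.prob_space)
  next
    case False
    have [measurable]: "(\<lambda>\<omega>. \<integral>x. h x \<partial>P \<omega>) \<in> borel_measurable W"
      by (rule measurable_compose[OF P]) measurable
    have "(\<integral>\<omega>. (1 + l * (\<integral>x. h x \<partial>P \<omega>)) powr (- \<theta>) \<partial>W) = (\<integral>\<omega>. \<phi> l (N \<omega>) \<partial>W)"
    proof (rule integral_cong_AE)
      show "AE \<omega> in W. (1 + l * (\<integral>x. h x \<partial>P \<omega>)) powr (- \<theta>) = \<phi> l (N \<omega>)"
        using * by eventually_elim (simp add: \<phi>_ennreal)
    qed measurable
    with transform[of l] False that show ?thesis by simp
  qed
qed

text \<open>
  A partition of the target pulls back to a partition of the source with the same masses. This yields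
  a Dirichlet process for every image of a base distribution for which one is available.
\<close>

lemma dirichlet_process_distr:
  fixes f :: "'a \<Rightarrow> 'b"
  assumes DP: "dirichlet_process W \<theta> F P" and f [measurable]: "f \<in> F \<rightarrow>\<^sub>M K"
  shows "dirichlet_process W \<theta> (distr F K f) (\<lambda>\<omega>. distr (P \<omega>) K f)"
  unfolding dirichlet_process_def
proof (intro conjI allI impI)
  show W: "prob_space W"
    using DP by (simp add: dirichlet_process_def)
  have "prob_algebra (distr F K f) = prob_algebra K"
    unfolding prob_algebra_def by (subst subprob_algebra_cong[of _ K]) auto
  moreover have "P \<in> W \<rightarrow>\<^sub>M prob_algebra F"
    using DP by (simp add: dirichlet_process_def)
  ultimately show "(\<lambda>\<omega>. distr (P \<omega>) K f) \<in> W \<rightarrow>\<^sub>M prob_algebra (distr F K f)"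
    using measurable_compose[OF _ measurable_distr_prob_space[OF f]] by simp
  fix k and C :: "nat \<Rightarrow> 'b set"
  assume C: "(\<forall>i<k. C i \<in> sets (distr F K f)) \<and> disjoint_family_on C {..<k} \<and> (\<Union>i<k. C i) = space (distr F K f)"
  let ?D = "\<lambda>i. f -` C i \<inter> space F"
  have D: "\<forall>i<k. ?D i \<in> sets F"
    using C by (auto intro!: measurable_sets[OF f])
  have "disjoint_family_on ?D {..<k}"
    using C by (auto simp: disjoint_family_on_def)
  moreover have "(\<Union>i<k. ?D i) = space F"
  proof -
    have "(\<Union>i<k. ?D i) = f -` (\<Union>i<k. C i) \<inter> space F"
      by auto
    also have "\<dots> = space F"
      using C measurable_space[OF f] by auto
    finally show ?thesis .
  qed
  ultimately have "distr W (\<Pi>\<^sub>M i\<in>{..<k}. borel) (\<lambda>\<omega>. \<lambda>i\<in>{..<k}. measure (P \<omega>) (?D i)) =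
      dirichlet_law {..<k} (\<lambda>i. \<theta> * measure F (?D i))"
    using DP D by (simp add: dirichlet_process_def)
  moreover have "distr W (\<Pi>\<^sub>M i\<in>{..<k}. borel) (\<lambda>\<omega>. \<lambda>i\<in>{..<k}. measure (P \<omega>) (?D i)) =
      distr W (\<Pi>\<^sub>M i\<in>{..<k}. borel) (\<lambda>\<omega>. \<lambda>i\<in>{..<k}. measure (distr (P \<omega>) K f) (C i))"
  proof (intro distr_cong refl restrict_ext)
    fix \<omega> i assume "\<omega> \<in> space W" "i \<in> {..<k}"
    moreover from this have "f \<in> P \<omega> \<rightarrow>\<^sub>M K"
      using dirichlet_process_kernel_measurable[OF DP _ f] by simp
    ultimately show "measure (P \<omega>) (?D i) = measure (distr (P \<omega>) K f) (C i)"
      using C dirichlet_process_kernel(3)[OF DP] by (simp add: measure_distr)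
  qed
  moreover have "dirichlet_law {..<k} (\<lambda>i. \<theta> * measure F (?D i)) = dirichlet_law {..<k} (\<lambda>i. \<theta> * measure (distr F K f) (C i))"
  proof -
    have "gamma_law (\<theta> * measure F (?D i)) = gamma_law (\<theta> * measure (distr F K f) (C i))" if "i \<in> {..<k}" for i
      using that C by (simp add: measure_distr)
    then show ?thesis
      unfolding dirichlet_law_def by (intro distr_cong PiM_cong) auto
  qed
  ultimately show "distr W (\<Pi>\<^sub>M i\<in>{..<k}. borel) (\<lambda>\<omega>. \<lambda>i\<in>{..<k}. measure (distr (P \<omega>) K f) (C i)) =
      dirichlet_law {..<k} (\<lambda>i. \<theta> * measure (distr F K f) (C i))"
    by simp
qed

section \<open>Moments, Laplace transforms and Stieltjes transforms on the unit interval\<close>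

text \<open>
  Letting \<open>x\<close> tend to \<open>0\<close> gives \<open>d 0 = 0\<close>; dividing by \<open>x\<close> leaves a series of the same kind. The point
  \<open>x = 0\<close> is excluded in the hypothesis because it is lost in this division.
\<close>

lemma power_series_zero_coeff_zero:
  fixes d :: "nat \<Rightarrow> real"
  assumes "0 < s" "\<And>x. x \<noteq> 0 \<Longrightarrow> \<bar>x\<bar> < s \<Longrightarrow> (\<lambda>n. d n * x ^ n) sums 0"
  shows "d n = 0"
  using assms(2)
proof (induction n arbitrary: d)
  have *: "d 0 = 0" if "\<And>x. x \<noteq> 0 \<Longrightarrow> \<bar>x\<bar> < s \<Longrightarrow> (\<lambda>n. d n * x ^ n) sums 0" for d :: "nat \<Rightarrow> real"
  proof -
    have "((\<lambda>_::real. 0) \<longlongrightarrow> d 0) (at 0)"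
      by (rule powser_limit_0_strong[of s d "\<lambda>_. 0"]) (use assms(1) that in auto)
    then show ?thesis
      using LIM_const_eq by fastforce
  qed
  case 0
  then show ?case using * by blast
  case (Suc n)
  have "(\<lambda>n. d (Suc n) * x ^ n) sums 0" if x: "x \<noteq> 0" "\<bar>x\<bar> < s" for x
  proof -
    have "(\<lambda>n. d (Suc n) * x ^ Suc n) sums (0 - d 0 * x ^ 0)"
      using Suc.prems[OF x] by (subst sums_Suc_iff[of "\<lambda>n. d n * x ^ n"]) simp
    then have "(\<lambda>n. inverse x * (d (Suc n) * x ^ Suc n)) sums (inverse x * 0)"
      using *[of d] Suc.prems by (intro sums_mult) simp
    then show ?thesis
      using x by (simp add: field_simps)
  qed
  then show ?case
    by (rule Suc.IH)
qed

text \<open>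
  Both the exponential and the binomial series are integrated term by term below; the coefficients may
  be complex.
\<close>

lemma integral_power_series_unit_interval:
  fixes c :: "nat \<Rightarrow> 'b :: {banach, second_countable_topology}"
  assumes "prob_space M" and [measurable_cong]: "sets M = sets borel"
    and AE: "AE x in M. 0 \<le> x \<and> x \<le> (1::real)" and c: "summable (\<lambda>n. norm (c n))"
  shows "(\<integral>x. (\<Sum>n. x ^ n *\<^sub>R c n) \<partial>M) = (\<Sum>n. (\<integral>x. x ^ n \<partial>M) *\<^sub>R c n)"
    and "summable (\<lambda>n. (\<integral>x. x ^ n \<partial>M) *\<^sub>R c n)"
proof -
  interpret prob_space M by fact
  have int: "integrable M (\<lambda>x. x ^ n)" for n
    by (rule integrable_const_bound[where B = 1])
       (use AE in eventually_elim, auto simp: power_le_one)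
  have b: "AE x in M. norm (x ^ n *\<^sub>R c n) \<le> norm (c n)" for n
    using AE by eventually_elim (auto intro!: mult_left_le_one_le power_le_one)
  have 1: "integrable M (\<lambda>x. x ^ n *\<^sub>R c n)" for n
    using int by simp
  have 2: "AE x in M. summable (\<lambda>n. norm (x ^ n *\<^sub>R c n))"
    using b[unfolded AE_all_countable[symmetric]] AE
    by eventually_elim (auto intro!: summable_comparison_test'[OF c, of 0] mult_left_le_one_le power_le_one)
  have 3: "summable (\<lambda>n. \<integral>x. norm (x ^ n *\<^sub>R c n) \<partial>M)"
  proof (rule summable_comparison_test'[OF c, of 0])
    fix n
    have "(\<integral>x. norm (x ^ n *\<^sub>R c n) \<partial>M) \<le> (\<integral>x. norm (c n) \<partial>M)"
      using b[of n] 1[of n] by (intro integral_mono_AE integrable_norm) auto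
    then show "norm (\<integral>x. norm (x ^ n *\<^sub>R c n) \<partial>M) \<le> norm (c n)"
      by (simp add: prob_space del: norm_scaleR)
  qed
  show "(\<integral>x. (\<Sum>n. x ^ n *\<^sub>R c n) \<partial>M) = (\<Sum>n. (\<integral>x. x ^ n \<partial>M) *\<^sub>R c n)"
    using integral_suminf[OF 1 2 3] int by simp
  show "summable (\<lambda>n. (\<integral>x. x ^ n \<partial>M) *\<^sub>R c n)"
    using summable_integral[OF 1 2 3] int by simp
qed

text \<open>
  Expanding the exponential shows that the moments determine the characteristic function.
\<close>

lemma moments_unit_interval_unique:
  fixes M N :: "real measure"
  assumes M: "prob_space M" "sets M = sets borel" "AE x in M. 0 \<le> x \<and> x \<le> 1"
    and N: "prob_space N" "sets N = sets borel" "AE x in N. 0 \<le> x \<and> x \<le> 1"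
    and eq: "\<And>n. (\<integral>x. x ^ n \<partial>M) = (\<integral>x. x ^ n \<partial>N)"
  shows "M = N"
proof (rule Levy_uniqueness)
  show "real_distribution M" "real_distribution N"
    using M N by (auto simp: real_distribution_def real_distribution_axioms_def)
  have char: "char L t = (\<Sum>n. (\<integral>x. x ^ n \<partial>L) *\<^sub>R ((\<i> * complex_of_real t) ^ n /\<^sub>R fact n))"
    if "prob_space L" "sets L = sets borel" "AE x in L. 0 \<le> x \<and> x \<le> 1" for L t
  proof -
    have "iexp (t * x) = (\<Sum>n. x ^ n *\<^sub>R ((\<i> * complex_of_real t) ^ n /\<^sub>R fact n))" for x
      unfolding exp_def by (intro suminf_cong) (simp add: power_mult_distrib scaleR_conv_of_real)
    then show ?thesis
      unfolding char_def using integral_power_series_unit_interval(1)[OF that summable_norm_exp] by simp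
  qed
  show "char M = char N"
    using char[OF M] char[OF N] eq by auto
qed

text \<open>
  By the binomial series the transform is a power series in \<open>l\<close> whose coefficients are the moments times
  binomial coefficients of \<open>- \<theta>\<close>; these do not vanish because \<open>\<theta>\<close> is positive.
\<close>

lemma Stieltjes_unit_interval_unique:
  fixes M N :: "real measure" and \<theta> :: real
  assumes M: "prob_space M" "sets M = sets borel" "AE x in M. 0 \<le> x \<and> x \<le> 1"
    and N: "prob_space N" "sets N = sets borel" "AE x in N. 0 \<le> x \<and> x \<le> 1"
    and \<theta>: "\<theta> > 0"
    and eq: "\<And>l. \<bar>l\<bar> < 1 \<Longrightarrow> (\<integral>x. (1 + l * x) powr (- \<theta>) \<partial>M) = (\<integral>x. (1 + l * x) powr (- \<theta>) \<partial>N)"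
  shows "M = N"
proof (rule moments_unit_interval_unique[OF M N])
  define c where "c n = (- \<theta>) gchoose n" for n
  have c: "c n \<noteq> 0" for n
    using \<theta> by (auto simp: c_def gbinomial_prod_rev)
  have sums: "(\<lambda>n. (c n * (\<integral>x. x ^ n \<partial>L)) * l ^ n) sums (\<integral>x. (1 + l * x) powr (- \<theta>) \<partial>L)"
    if L: "prob_space L" "sets L = sets borel" "AE x in L. 0 \<le> x \<and> x \<le> 1" and l: "\<bar>l\<bar> < 1" for L l
  proof -
    have abs: "summable (\<lambda>n. norm (c n * l ^ n))"
    proof -
      \<comment> \<open>Convergence at a point beyond \<open>l\<close> gives absolute convergence at \<open>l\<close>.\<close>
      define k where "k = (1 + \<bar>l\<bar>) / 2"
      have "summable (\<lambda>n. c n * k ^ n)"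
        using gen_binomial_real[of k "- \<theta>"] l by (auto simp: c_def k_def sums_iff)
      from powser_insidea[OF this, of l] show ?thesis
        using l by (auto simp: k_def)
    qed
    have [measurable_cong]: "sets L = sets borel" by fact
    have "(\<integral>x. (1 + l * x) powr (- \<theta>) \<partial>L) = (\<integral>x. (\<Sum>n. x ^ n *\<^sub>R (c n * l ^ n)) \<partial>L)"
    proof (rule integral_cong_AE)
      show "AE x in L. (1 + l * x) powr (- \<theta>) = (\<Sum>n. x ^ n *\<^sub>R (c n * l ^ n))"
        using L(3)
      proof eventually_elim
        case (elim x)
        then have "\<bar>l * x\<bar> < 1"
          using l by (simp add: abs_mult) (metis abs_ge_zero l mult_left_le order_le_less_trans)
        from gen_binomial_real[OF this, of "- \<theta>"] show ?case
          by (simp add: c_def sums_iff power_mult_distrib mult_ac)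
      qed
    qed measurable
    then show ?thesis
      using integral_power_series_unit_interval[OF L abs]
      by (simp add: sums_iff mult_ac)
  qed
  fix n
  have "(c n * ((\<integral>x. x ^ n \<partial>M) - (\<integral>x. x ^ n \<partial>N))) = 0"
  proof (rule power_series_zero_coeff_zero[of 1])
    fix l :: real assume "\<bar>l\<bar> < 1"
    from sums_diff[OF sums[OF M this] sums[OF N this]] eq[OF this]
    show "(\<lambda>n. c n * ((\<integral>x. x ^ n \<partial>M) - (\<integral>x. x ^ n \<partial>N)) * l ^ n) sums 0"
      by (simp add: algebra_simps)
  qed simp
  with c[of n] show "(\<integral>x. x ^ n \<partial>M) = (\<integral>x. x ^ n \<partial>N)"
    by simp
qed

text \<open>
  The Laplace transform at the natural numbers lists the moments of \<open>exp (- x)\<close>, which lies in the unit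
  interval.
\<close>

lemma Laplace_transform_unique:
  fixes M N :: "real measure"
  assumes M: "prob_space M" "sets M = sets borel" "AE x in M. 0 \<le> x"
    and N: "prob_space N" "sets N = sets borel" "AE x in N. 0 \<le> x"
    and eq: "\<And>l. l \<ge> 0 \<Longrightarrow> (\<integral>x. exp (- l * x) \<partial>M) = (\<integral>x. exp (- l * x) \<partial>N)"
  shows "M = N"
proof -
  have [measurable_cong]: "sets M = sets borel" "sets N = sets borel" by fact+
  have "distr M borel (\<lambda>x. exp (- x)) = distr N borel (\<lambda>x. exp (- x))"
  proof (rule moments_unit_interval_unique)
    show "prob_space (distr M borel (\<lambda>x. exp (- x)))" "prob_space (distr N borel (\<lambda>x. exp (- x)))"
      using M(1) N(1) by (auto intro!: prob_space.prob_space_distr)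
    show "AE x in distr M borel (\<lambda>x. exp (- x)). 0 \<le> x \<and> x \<le> 1"
      using M(3) by (subst AE_distr_iff) auto
    show "AE x in distr N borel (\<lambda>x. exp (- x)). 0 \<le> x \<and> x \<le> 1"
      using N(3) by (subst AE_distr_iff) auto
    show "(\<integral>x. x ^ n \<partial>distr M borel (\<lambda>x. exp (- x))) = (\<integral>x. x ^ n \<partial>distr N borel (\<lambda>x. exp (- x)))" for n
      using eq[of "real n"] by (simp add: integral_distr exp_of_nat_mult[symmetric])
  qed simp_all
  then have "distr (distr M borel (\<lambda>x. exp (- x))) borel (\<lambda>y. - ln y) =
      distr (distr N borel (\<lambda>x. exp (- x))) borel (\<lambda>y. - ln y)"
    by simp
  then show ?thesis
    using M(2) N(2) by (simp add: distr_distr o_def distr_id2)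
qed

section \<open>Tilting by a power weight\<close>

text \<open>
  For \<open>\<mu>\<close> the law of a Dirichlet mean and a suitable normalising constant \<open>C\<close> this is the law of the mean
  of the transformed base distribution. It reflects the factorisation
  \<open>1 + c * (1 + l) * m = (1 + c * m) * (1 + l * (c * m / (1 + c * m)))\<close>: the weight absorbs the first
  factor and the push-forward produces the second.
\<close>

definition stieltjes_tilt :: "real \<Rightarrow> real \<Rightarrow> real \<Rightarrow> real measure \<Rightarrow> real measure" where
  "stieltjes_tilt \<theta> c C \<mu> =
     distr (density \<mu> (\<lambda>m. ennreal (C * (1 + c * m) powr (- \<theta>)))) borel (\<lambda>m. c * m / (1 + c * m))"

lemma sets_stieltjes_tilt [simp, measurable_cong]: "sets (stieltjes_tilt \<theta> c C \<mu>) = sets borel"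
  by (simp add: stieltjes_tilt_def)

lemma nn_integral_stieltjes_tilt:
  assumes [measurable_cong]: "sets \<mu> = sets borel" and [measurable]: "f \<in> borel_measurable borel"
  shows "(\<integral>\<^sup>+y. f y \<partial>stieltjes_tilt \<theta> c C \<mu>) =
    (\<integral>\<^sup>+m. ennreal (C * (1 + c * m) powr (- \<theta>)) * f (c * m / (1 + c * m)) \<partial>\<mu>)"
  unfolding stieltjes_tilt_def by (simp add: nn_integral_distr nn_integral_density)

lemma AE_stieltjes_tilt:
  assumes [measurable_cong]: "sets \<mu> = sets borel" and \<mu>: "AE m in \<mu>. 0 \<le> m" and c: "c > 0"
  shows "AE y in stieltjes_tilt \<theta> c C \<mu>. 0 \<le> y \<and> y < 1"
  unfolding stieltjes_tilt_def
proof (subst AE_distr_iff)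
  show "AE m in density \<mu> (\<lambda>m. ennreal (C * (1 + c * m) powr (- \<theta>))). 0 \<le> c * m / (1 + c * m) \<and> c * m / (1 + c * m) < 1"
  proof (subst AE_density)
    show "AE m in \<mu>. 0 < ennreal (C * (1 + c * m) powr (- \<theta>)) \<longrightarrow> 0 \<le> c * m / (1 + c * m) \<and> c * m / (1 + c * m) < 1"
      using \<mu>
    proof eventually_elim
      case (elim m)
      then have "0 \<le> c * m"
        using c by simp
      then show ?case by simp
    qed
  qed measurable
qed auto

text \<open>
  Under \<open>y = c * m / (1 + c * m)\<close> one has \<open>1 - y = 1 / (1 + c * m)\<close>, so the weight can be undone on the
  image.
\<close>

lemma nn_integral_untilt:
  assumes [measurable_cong]: "sets \<mu> = sets borel" and \<mu>: "AE m in \<mu>. 0 \<le> m" and c: "c > 0" "C > 0"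
    and [measurable]: "f \<in> borel_measurable borel"
  shows "(\<integral>\<^sup>+m. f m \<partial>\<mu>) =
    (\<integral>\<^sup>+y. ennreal (1 / C * (1 - y) powr (- \<theta>)) * f (y / (c * (1 - y))) \<partial>stieltjes_tilt \<theta> c C \<mu>)"
proof -
  have "(\<integral>\<^sup>+y. ennreal (1 / C * (1 - y) powr (- \<theta>)) * f (y / (c * (1 - y))) \<partial>stieltjes_tilt \<theta> c C \<mu>) =
      (\<integral>\<^sup>+m. ennreal (C * (1 + c * m) powr (- \<theta>)) *
        (ennreal (1 / C * (1 - c * m / (1 + c * m)) powr (- \<theta>)) *
          f ((c * m / (1 + c * m)) / (c * (1 - c * m / (1 + c * m))))) \<partial>\<mu>)"
    by (rule nn_integral_stieltjes_tilt) (use assms(1) in measurable)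
  also have "\<dots> = (\<integral>\<^sup>+m. f m \<partial>\<mu>)"
  proof (rule nn_integral_cong_AE, use \<mu> in eventually_elim)
    case (elim m)
    have p: "1 + c * m > 0"
      using elim c by (simp add: add_pos_nonneg)
    have 1: "1 - c * m / (1 + c * m) = inverse (1 + c * m)"
      using p by (simp add: field_simps)
    have 2: "(c * m / P) / (c * inverse P) = m" if "P \<noteq> 0" for P
      using c that by (simp add: field_simps)
    have "C * (1 + c * m) powr (- \<theta>) * (1 / C * inverse (1 + c * m) powr (- \<theta>)) = 1"
      using p c by (simp add: powr_minus inverse_powr)
    then have "ennreal (C * (1 + c * m) powr (- \<theta>)) * ennreal (1 / C * inverse (1 + c * m) powr (- \<theta>)) = 1"
      using c by (simp add: ennreal_mult'[symmetric])
    then show ?case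
      using 2[of "1 + c * m"] p unfolding 1 by (simp add: mult.assoc[symmetric] del: times_divide_eq_right)
  qed
  finally show ?thesis ..
qed

lemma stieltjes_tilt_inject:
  assumes "sets \<mu> = sets borel" "AE m in \<mu>. 0 \<le> m" "sets \<nu> = sets borel" "AE m in \<nu>. 0 \<le> m"
    and "c > 0" "C > 0" and "stieltjes_tilt \<theta> c C \<mu> = stieltjes_tilt \<theta> c C \<nu>"
  shows "\<mu> = \<nu>"
proof (rule measure_eqI)
  show "sets \<mu> = sets \<nu>"
    using assms by simp
  fix A assume A: "A \<in> sets \<mu>"
  with assms have "A \<in> sets borel" "A \<in> sets \<nu>"
    by auto
  with A show "emeasure \<mu> A = emeasure \<nu> A"
    using nn_integral_untilt[of \<mu> c C "indicator A" \<theta>] nn_integral_untilt[of \<nu> c C "indicator A" \<theta>] assms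
    by simp
qed

text \<open>
  Tilting shifts the argument of the transform. In particular the transform of a tilted measure is
  known on a neighbourhood of \<open>0\<close> as soon as the original one is known on the positive half line.
\<close>

lemma Stieltjes_transform_of_tilt:
  assumes [measurable_cong]: "sets \<mu> = sets borel" and \<mu>: "AE m in \<mu>. 0 \<le> m" and c: "c > 0" "C \<ge> 0" and l: "l > -1"
  shows "(\<integral>y. (1 + l * y) powr (- \<theta>) \<partial>stieltjes_tilt \<theta> c C \<mu>) = C * (\<integral>m. (1 + c * (1 + l) * m) powr (- \<theta>) \<partial>\<mu>)"
proof -
  have "(\<integral>y. (1 + l * y) powr (- \<theta>) \<partial>stieltjes_tilt \<theta> c C \<mu>) =
      (\<integral>m. (C * (1 + c * m) powr (- \<theta>)) * (1 + l * (c * m / (1 + c * m))) powr (- \<theta>) \<partial>\<mu>)"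
    unfolding stieltjes_tilt_def using c by (simp add: integral_distr integral_density)
  also have "\<dots> = (\<integral>m. C * (1 + c * (1 + l) * m) powr (- \<theta>) \<partial>\<mu>)"
  proof (rule integral_cong_AE)
    show "AE m in \<mu>. (C * (1 + c * m) powr (- \<theta>)) * (1 + l * (c * m / (1 + c * m))) powr (- \<theta>) = C * (1 + c * (1 + l) * m) powr (- \<theta>)"
      using \<mu>
    proof eventually_elim
      case (elim m)
      have p: "1 + c * m > 0"
        using elim c by (simp add: add_pos_nonneg)
      have q: "1 + c * (1 + l) * m \<ge> 0"
        using elim c l by simp
      have "1 + l * (c * m / (1 + c * m)) = (1 + c * (1 + l) * m) / (1 + c * m)"
        using p by (simp add: field_simps)
      then show ?case
        using p q by (simp add: powr_divide)
    qed
  qed measurable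
  finally show ?thesis by simp
qed

lemma integrable_Stieltjes:
  fixes \<mu> :: "real measure" and c \<theta> :: real
  assumes "prob_space \<mu>" and [measurable_cong]: "sets \<mu> = sets borel" and \<mu>: "AE m in \<mu>. 0 \<le> m" and "c \<ge> 0" "\<theta> \<ge> 0"
  shows "integrable \<mu> (\<lambda>m. (1 + c * m) powr (- \<theta>))"
proof -
  interpret prob_space \<mu> by fact
  have "AE m in \<mu>. norm ((1 + c * m) powr (- \<theta>)) \<le> 1"
    using \<mu>
  proof eventually_elim
    case (elim m)
    then have "1 \<le> (1 + c * m) powr \<theta>"
      by (intro ge_one_powr_ge_zero) (use assms in auto)
    then show ?case
      by (simp add: powr_minus inverse_le_1_iff)
  qed
  then show ?thesis
    by (rule integrable_const_bound) measurable
qed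

lemma prob_space_stieltjes_tilt:
  assumes "prob_space \<mu>" and sets: "sets \<mu> = sets borel" and \<mu>: "AE m in \<mu>. 0 \<le> m" and "c > 0" "\<theta> \<ge> 0" "C \<ge> 0"
    and C: "C * (\<integral>m. (1 + c * m) powr (- \<theta>) \<partial>\<mu>) = 1"
  shows "prob_space (stieltjes_tilt \<theta> c C \<mu>)"
proof (rule prob_spaceI)
  have "(\<integral>\<^sup>+y. 1 \<partial>stieltjes_tilt \<theta> c C \<mu>) = (\<integral>\<^sup>+m. ennreal (C * (1 + c * m) powr (- \<theta>)) \<partial>\<mu>)"
    by (subst nn_integral_stieltjes_tilt[OF sets]) auto
  also have "\<dots> = ennreal (\<integral>m. C * (1 + c * m) powr (- \<theta>) \<partial>\<mu>)"
    using assms by (intro nn_integral_eq_integral integrable_mult_right integrable_Stieltjes) auto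
  finally show "emeasure (stieltjes_tilt \<theta> c C \<mu>) (space (stieltjes_tilt \<theta> c C \<mu>)) = 1"
    using C by simp
qed

text \<open>
  On an unbounded support there may be no moments. Tilting with \<open>c = 1\<close> moves both measures to the unit
  interval, where the transforms agree for all \<open>\<bar>l\<bar> < 1\<close>, and tilting is injective.
\<close>

lemma Stieltjes_transform_unique:
  fixes \<mu> \<nu> :: "real measure" and \<theta> :: real
  assumes \<mu>: "prob_space \<mu>" "sets \<mu> = sets borel" "AE x in \<mu>. 0 \<le> x"
    and \<nu>: "prob_space \<nu>" "sets \<nu> = sets borel" "AE x in \<nu>. 0 \<le> x"
    and \<theta>: "\<theta> > 0"
    and eq: "\<And>l. l > 0 \<Longrightarrow> (\<integral>x. (1 + l * x) powr (- \<theta>) \<partial>\<mu>) = (\<integral>x. (1 + l * x) powr (- \<theta>) \<partial>\<nu>)"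
  shows "\<mu> = \<nu>"
proof -
  \<comment> \<open>Tilting yields a probability measure when normalised by the transform at \<open>1\<close>.\<close>
  define I where "I = (\<integral>x. (1 + 1 * x) powr (- \<theta>) \<partial>\<mu>)"
  interpret \<mu>: prob_space \<mu> by fact
  have pos: "AE x in \<mu>. (1 + 1 * x) powr (- \<theta>) > 0"
    using \<mu>(3) by eventually_elim simp
  have int: "integrable \<mu> (\<lambda>x. (1 + 1 * x) powr (- \<theta>))"
    using integrable_Stieltjes[OF \<mu>, of 1 \<theta>] \<theta> by simp
  have "I \<noteq> 0"
  proof
    assume "I = 0"
    then have "AE x in \<mu>. (1 + 1 * x) powr (- \<theta>) = 0"
      unfolding I_def using int by (subst (asm) integral_nonneg_eq_0_iff_AE) auto
    with pos have "AE x in \<mu>. False"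
      by eventually_elim simp
    then show False by simp
  qed
  moreover have "I \<ge> 0"
    unfolding I_def by simp
  ultimately have I: "I > 0" by simp
  have I': "1 / I * (\<integral>x. (1 + 1 * x) powr (- \<theta>) \<partial>\<mu>) = 1" "1 / I * (\<integral>x. (1 + 1 * x) powr (- \<theta>) \<partial>\<nu>) = 1"
    using I eq[of 1] unfolding I_def by auto
  have "stieltjes_tilt \<theta> 1 (1 / I) \<mu> = stieltjes_tilt \<theta> 1 (1 / I) \<nu>"
  proof (rule Stieltjes_unit_interval_unique[OF _ _ _ _ _ _ \<theta>])
    show "prob_space (stieltjes_tilt \<theta> 1 (1 / I) \<mu>)" "prob_space (stieltjes_tilt \<theta> 1 (1 / I) \<nu>)"
      using prob_space_stieltjes_tilt[OF \<mu>, of 1 \<theta> "1 / I"] prob_space_stieltjes_tilt[OF \<nu>, of 1 \<theta> "1 / I"] I I' \<theta> by auto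
    show "AE y in stieltjes_tilt \<theta> 1 (1 / I) \<mu>. 0 \<le> y \<and> y \<le> 1"
      using AE_stieltjes_tilt[OF \<mu>(2,3), of 1] by (rule AE_mp) auto
    show "AE y in stieltjes_tilt \<theta> 1 (1 / I) \<nu>. 0 \<le> y \<and> y \<le> 1"
      using AE_stieltjes_tilt[OF \<nu>(2,3), of 1] by (rule AE_mp) auto
    show "(\<integral>y. (1 + l * y) powr (- \<theta>) \<partial>stieltjes_tilt \<theta> 1 (1 / I) \<mu>) = (\<integral>y. (1 + l * y) powr (- \<theta>) \<partial>stieltjes_tilt \<theta> 1 (1 / I) \<nu>)"
      if "\<bar>l\<bar> < 1" for l
      using Stieltjes_transform_of_tilt[OF \<mu>(2,3), of 1 "1 / I" l \<theta>] Stieltjes_transform_of_tilt[OF \<nu>(2,3), of 1 "1 / I" l \<theta>]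
        eq[of "1 + l"] I that by (simp add: abs_less_iff)
  qed simp_all
  then show ?thesis
    using I by (intro stieltjes_tilt_inject[OF \<mu>(2,3) \<nu>(2,3)]) auto
qed

text \<open>
  The substitution \<open>m = y / (c * (1 - y))\<close> is singular at \<open>1\<close>, so it is carried out on the compact intervals
  \<open>{0..b n}\<close> with \<open>b n\<close> increasing to \<open>1\<close>.
\<close>

lemma nn_integral_substitution_odds:
  assumes c: "c > 0" and f [measurable]: "f \<in> borel_measurable borel"
  shows "(\<integral>\<^sup>+m. f m * indicator {0<..} m \<partial>lborel) =
    (\<integral>\<^sup>+y. ennreal (1 / (c * (1 - y)\<^sup>2)) * f (y / (c * (1 - y))) * indicator {0<..<1} y \<partial>lborel)"
proof -
  define g where "g y = y / (c * (1 - y))" for y :: real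
  define g' where "g' y = 1 / (c * (1 - y)\<^sup>2)" for y :: real
  define b where "b n = 1 - 1 / real (n + 2)" for n
  have b: "0 < b n" "b n < 1" for n
    by (simp_all add: b_def)
  have gb: "g (b n) = real (n + 1) / c" for n
  proof -
    have "b n = real (n + 1) / real (n + 2)" "1 - b n = 1 / real (n + 2)"
      by (simp_all add: b_def field_simps)
    then show ?thesis
      using c unfolding g_def by (simp only:) simp
  qed
  have eq: "(\<integral>\<^sup>+m. f m * indicator {0..real (n + 1) / c} m \<partial>lborel) =
      (\<integral>\<^sup>+y. f (g y) * ennreal (g' y) * indicator {0..b n} y \<partial>lborel)" for n
  proof -
    have "(\<integral>\<^sup>+m. f m * indicator {g 0..g (b n)} m \<partial>lborel) =
        (\<integral>\<^sup>+y. f (g y) * ennreal (g' y) * indicator {0..b n} y \<partial>lborel)"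
    proof (rule nn_integral_substitution_aux)
      fix x assume x: "x \<in> {0..b n}"
      then have "x < 1" using b[of n] by auto
      then show "(g has_real_derivative g' x) (at x)"
        unfolding g_def[abs_def] g'_def using c
        by (auto intro!: derivative_eq_intros simp: divide_simps) (simp add: algebra_simps power2_eq_square)
      show "g' x \<ge> 0"
        using c by (simp add: g'_def)
    next
      show "continuous_on {0..b n} g'"
        unfolding g'_def[abs_def] using c b[of n] by (auto intro!: continuous_intros)
    qed (use b in auto)
    then show ?thesis
      unfolding gb by (simp add: g_def)
  qed
  have [measurable]: "g \<in> borel_measurable borel" "g' \<in> borel_measurable borel"
    unfolding g_def[abs_def] g'_def[abs_def] by measurable
  have "(\<lambda>n. \<integral>\<^sup>+m. f m * indicator {0..real (n + 1) / c} m \<partial>lborel) \<longlonglongrightarrow> (\<integral>\<^sup>+m. f m * indicator {0..} m \<partial>lborel)"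
  proof (rule nn_integral_LIMSEQ)
    show "incseq (\<lambda>n m. f m * indicator {0..real (n + 1) / c} m)"
      using c by (auto simp: incseq_def le_fun_def indicator_def divide_le_cancel intro: order_trans)
    fix m
    have "eventually (\<lambda>n. c * m \<le> real n) sequentially"
      by real_asymp
    then have "eventually (\<lambda>n. f m * indicator {0..real (n + 1) / c} m = f m * indicator {0..} m) sequentially"
      by eventually_elim (use c in \<open>auto simp: indicator_def field_simps\<close>)
    then show "(\<lambda>n. f m * indicator {0..real (n + 1) / c} m) \<longlonglongrightarrow> f m * indicator {0..} m"
      by (rule tendsto_eventually)
  qed measurable
  moreover have "(\<lambda>n. \<integral>\<^sup>+y. f (g y) * ennreal (g' y) * indicator {0..b n} y \<partial>lborel) \<longlonglongrightarrow>
      (\<integral>\<^sup>+y. f (g y) * ennreal (g' y) * indicator {0..<1} y \<partial>lborel)"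
  proof (rule nn_integral_LIMSEQ)
    have "mono b"
      by (auto simp: b_def incseq_def field_simps)
    then show "incseq (\<lambda>n y. f (g y) * ennreal (g' y) * indicator {0..b n} y)"
      by (auto simp: incseq_def le_fun_def indicator_def intro: order_trans)
    fix y
    have "eventually (\<lambda>n. y \<ge> 1 \<or> y \<le> b n) sequentially"
    proof (cases "y \<ge> 1")
      case False
      have "b \<longlonglongrightarrow> 1"
        unfolding b_def by real_asymp
      then have "eventually (\<lambda>n. y < b n) sequentially"
        using False by (intro order_tendstoD) auto
      then show ?thesis by eventually_elim simp
    qed simp
    then have "eventually (\<lambda>n. f (g y) * ennreal (g' y) * indicator {0..b n} y = f (g y) * ennreal (g' y) * indicator {0..<1} y) sequentially"
      by eventually_elim (use b in \<open>auto simp: indicator_def intro: order_le_less_trans\<close>)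
    then show "(\<lambda>n. f (g y) * ennreal (g' y) * indicator {0..b n} y) \<longlonglongrightarrow> f (g y) * ennreal (g' y) * indicator {0..<1} y"
      by (rule tendsto_eventually)
  qed measurable
  ultimately have *: "(\<integral>\<^sup>+m. f m * indicator {0..} m \<partial>lborel) = (\<integral>\<^sup>+y. f (g y) * ennreal (g' y) * indicator {0..<1} y \<partial>lborel)"
    unfolding eq by (rule LIMSEQ_unique)
  have nz: "AE x in lborel. x \<noteq> (0::real)"
    by (rule AE_lborel_singleton)
  have "(\<integral>\<^sup>+m. f m * indicator {0<..} m \<partial>lborel) = (\<integral>\<^sup>+m. f m * indicator {0..} m \<partial>lborel)"
    by (rule nn_integral_cong_AE, use nz in eventually_elim) (auto simp: indicator_def)
  also have "\<dots> = (\<integral>\<^sup>+y. g' y * f (g y) * indicator {0<..<1} y \<partial>lborel)"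
    unfolding *
    by (rule nn_integral_cong_AE, use nz in eventually_elim) (auto simp: indicator_def mult_ac)
  finally show ?thesis
    unfolding g_def g'_def .
qed

text \<open>
  The exponent \<open>\<theta> - 2\<close> collects \<open>(1 - y) powr \<theta>\<close> from the weight and \<open>(1 - y) powr (- 2)\<close> from the
  derivative of the substitution.
\<close>

lemma stieltjes_tilt_density:
  fixes \<xi> :: "real \<Rightarrow> real"
  assumes \<mu>: "\<mu> = density lborel (\<lambda>x. ennreal (\<xi> x))" "AE m in \<mu>. 0 \<le> m" and c: "c > 0" "C \<ge> 0"
    and \<xi> [measurable]: "\<xi> \<in> borel_measurable borel" and nn: "\<And>x. 0 \<le> \<xi> x"
  shows "stieltjes_tilt \<theta> c C \<mu> = density lborel (\<lambda>y. ennreal (if 0 < y \<and> y < 1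
     then 1 / c * C * (1 - y) powr (\<theta> - 2) * \<xi> (y / (c * (1 - y))) else 0))"
proof (rule measure_eqI)
  have s: "sets \<mu> = sets borel"
    using \<mu>(1) by simp
  fix A assume "A \<in> sets (stieltjes_tilt \<theta> c C \<mu>)"
  then have A [measurable]: "A \<in> sets borel"
    by simp
  \<comment> \<open>A density may have arbitrary values on null sets; outside one of them it vanishes off the open half line.\<close>
  have AE: "AE m in lborel. 0 < \<xi> m \<longrightarrow> 0 < m"
  proof -
    have "AE m in lborel. 0 < \<xi> m \<longrightarrow> 0 \<le> m"
      using \<mu>(2) unfolding \<mu>(1) by (simp add: AE_density)
    with AE_lborel_singleton[of 0] show ?thesis
      by eventually_elim auto
  qed
  let ?F = "\<lambda>m. ennreal (\<xi> m) * (ennreal (C * (1 + c * m) powr (- \<theta>)) * indicator A (c * m / (1 + c * m)))"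
  have "emeasure (stieltjes_tilt \<theta> c C \<mu>) A = (\<integral>\<^sup>+m. ennreal (C * (1 + c * m) powr (- \<theta>)) * indicator A (c * m / (1 + c * m)) \<partial>\<mu>)"
    using nn_integral_stieltjes_tilt[OF s, of "indicator A"] by simp
  also have "\<dots> = (\<integral>\<^sup>+m. ?F m \<partial>lborel)"
    unfolding \<mu>(1) by (rule nn_integral_density) measurable
  also have "\<dots> = (\<integral>\<^sup>+m. ?F m * indicator {0<..} m \<partial>lborel)"
  proof (rule nn_integral_cong_AE, use AE in eventually_elim)
    case (elim m)
    then show ?case
      using nn[of m] by (cases "\<xi> m = 0") (auto simp: indicator_def)
  qed
  also have "\<dots> = (\<integral>\<^sup>+y. ennreal (1 / (c * (1 - y)\<^sup>2)) * ?F (y / (c * (1 - y))) * indicator {0<..<1} y \<partial>lborel)"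
    by (rule nn_integral_substitution_odds[OF c(1)]) measurable
  also have "\<dots> = (\<integral>\<^sup>+y. ennreal (if 0 < y \<and> y < 1
     then 1 / c * C * (1 - y) powr (\<theta> - 2) * \<xi> (y / (c * (1 - y))) else 0) * indicator A y \<partial>lborel)"
  proof (rule nn_integral_cong)
    fix y :: real
    show "ennreal (1 / (c * (1 - y)\<^sup>2)) * ?F (y / (c * (1 - y))) * indicator {0<..<1} y =
       ennreal (if 0 < y \<and> y < 1 then 1 / c * C * (1 - y) powr (\<theta> - 2) * \<xi> (y / (c * (1 - y))) else 0) * indicator A y"
    proof (cases "0 < y \<and> y < 1")
      case True
      define m where "m = y / (c * (1 - y))"
      have 1: "1 + c * m = inverse (1 - y)"
        using True c by (simp add: m_def field_simps)
      have 2: "c * m / inverse (1 - y) = y"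
        using True c by (simp add: m_def field_simps)
      have "1 / (c * (1 - y)\<^sup>2) * (\<xi> m * (C * inverse (1 - y) powr (- \<theta>))) = 1 / c * C * (1 - y) powr (\<theta> - 2) * \<xi> m"
        using True c by (simp add: powr_minus powr_diff powr_divide divide_simps)
      then have "ennreal (1 / (c * (1 - y)\<^sup>2)) * (ennreal (\<xi> m) * ennreal (C * inverse (1 - y) powr (- \<theta>)))
          = ennreal (1 / c * C * (1 - y) powr (\<theta> - 2) * \<xi> m)"
        using c nn[of m] by (simp add: ennreal_mult'[symmetric])
      then show ?thesis
        unfolding m_def[symmetric] 1 2 using True by (simp add: mult.assoc[symmetric])
    qed auto
  qed
  also have "\<dots> = emeasure (density lborel (\<lambda>y. ennreal (if 0 < y \<and> y < 1
     then 1 / c * C * (1 - y) powr (\<theta> - 2) * \<xi> (y / (c * (1 - y))) else 0))) A"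
    by (rule emeasure_density[symmetric]) auto
  finally show "emeasure (stieltjes_tilt \<theta> c C \<mu>) A = \<dots>" .
qed simp

text \<open>
  The density of the tilted measure is divided by the weight and carried back by the same substitution,
  read from right to left; with \<open>1 - y = 1 / (1 + c * x)\<close> the exponent is again \<open>\<theta> - 2\<close>.
\<close>

lemma density_of_stieltjes_tilt:
  fixes \<xi> :: "real \<Rightarrow> real"
  assumes s: "sets \<mu> = sets borel" and \<mu>: "AE m in \<mu>. 0 \<le> m" and c: "c > 0" "C > 0"
    and eq: "stieltjes_tilt \<theta> c C \<mu> = density lborel (\<lambda>x. ennreal (\<xi> x))"
    and \<xi> [measurable]: "\<xi> \<in> borel_measurable borel" and nn: "\<And>x. 0 \<le> \<xi> x"
  shows "\<mu> = density lborel (\<lambda>x. ennreal (if 0 < x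
     then c * (1 + c * x) powr (\<theta> - 2) * \<xi> (c * x / (1 + c * x)) / C else 0))"
proof (rule measure_eqI)
  fix A assume "A \<in> sets \<mu>"
  then have A [measurable]: "A \<in> sets borel"
    using s by simp
  have AE: "AE y in lborel. 0 < \<xi> y \<longrightarrow> 0 < y \<and> y < 1"
  proof -
    have "AE y in lborel. 0 < \<xi> y \<longrightarrow> 0 \<le> y \<and> y < 1"
      using AE_stieltjes_tilt[OF s \<mu> c(1), of \<theta> C] unfolding eq by (simp add: AE_density imp_conjR)
    with AE_lborel_singleton[of 0] show ?thesis
      by eventually_elim auto
  qed
  let ?h = "\<lambda>x. if 0 < x then c * (1 + c * x) powr (\<theta> - 2) * \<xi> (c * x / (1 + c * x)) / C else 0"
  let ?F = "\<lambda>y. ennreal (\<xi> y) * (ennreal (1 / C * (1 - y) powr (- \<theta>)) * indicator A (y / (c * (1 - y))))"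
  have "emeasure \<mu> A = (\<integral>\<^sup>+y. ennreal (1 / C * (1 - y) powr (- \<theta>)) * indicator A (y / (c * (1 - y))) \<partial>stieltjes_tilt \<theta> c C \<mu>)"
    using nn_integral_untilt[OF s \<mu> c, of "indicator A" \<theta>] s by simp
  also have "\<dots> = (\<integral>\<^sup>+y. ?F y \<partial>lborel)"
    unfolding eq by (rule nn_integral_density) measurable
  also have "\<dots> = (\<integral>\<^sup>+y. ennreal (1 / (c * (1 - y)\<^sup>2)) * (ennreal (?h (y / (c * (1 - y)))) * indicator A (y / (c * (1 - y)))) *
      indicator {0<..<1} y \<partial>lborel)"
  proof (rule nn_integral_cong_AE, use AE in eventually_elim)
    case (elim y)
    show ?case
    proof (cases "0 < y \<and> y < 1")
      case True
      define m where "m = y / (c * (1 - y))"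
      have 0: "m > 0"
        using True c by (simp add: m_def)
      have 1: "1 + c * m = inverse (1 - y)"
        using True c by (simp add: m_def field_simps)
      have 2: "c * m / inverse (1 - y) = y"
        using True c by (simp add: m_def field_simps)
      have "\<xi> y * (1 / C * (1 - y) powr (- \<theta>)) = 1 / (c * (1 - y)\<^sup>2) * ?h m"
        using True c 0 unfolding 1 2
        by (simp add: powr_minus powr_diff powr_divide divide_simps)
      then have "ennreal (\<xi> y) * ennreal (1 / C * (1 - y) powr (- \<theta>)) = ennreal (1 / (c * (1 - y)\<^sup>2)) * ennreal (?h m)"
        using c nn by (simp add: ennreal_mult'[symmetric])
      then show ?thesis
        unfolding m_def[symmetric] using True by (simp add: mult.assoc[symmetric] del: if_split)
    next
      case False
      then have "\<xi> y = 0"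
        using elim nn[of y] by (auto simp: less_le)
      with False show ?thesis by auto
    qed
  qed
  also have "\<dots> = (\<integral>\<^sup>+x. (ennreal (?h x) * indicator A x) * indicator {0<..} x \<partial>lborel)"
    by (rule nn_integral_substitution_odds[OF c(1), symmetric]) measurable
  also have "\<dots> = (\<integral>\<^sup>+x. ennreal (?h x) * indicator A x \<partial>lborel)"
    by (intro nn_integral_cong) (auto simp: indicator_def)
  also have "\<dots> = emeasure (density lborel (\<lambda>x. ennreal (?h x))) A"
    by (rule emeasure_density[symmetric]) auto
  finally show "emeasure \<mu> A = emeasure (density lborel (\<lambda>x. ennreal (?h x))) A" .
qed (use s in simp)

section \<open>Dirichlet means and generalized gamma convolutions\<close>

lemma borel_measurable_nonneg_borel:
  assumes "f \<in> borel_measurable borel"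
  shows "f \<in> borel_measurable nonneg_borel"
  unfolding nonneg_borel_def using assms by (rule measurable_restrict_space1)

lemma space_nonneg_borel [simp]: "space nonneg_borel = {0..}"
  by (simp add: nonneg_borel_def space_restrict_space)

lemma measurable_odds_inverse:
  assumes "c > 0"
  shows "(\<lambda>x. c * x / (c * x + 1)) \<in> nonneg_borel \<rightarrow>\<^sub>M nonneg_borel"
proof -
  have "(\<lambda>x. c * x / (c * x + 1)) \<in> borel_measurable nonneg_borel"
    by (rule borel_measurable_nonneg_borel) measurable
  then show ?thesis
    using assms by (subst (2) nonneg_borel_def) (auto intro!: measurable_restrict_space2)
qed

lemma dirichlet_mean_law_Stieltjes:
  assumes F: "prob_space F" "sets F = sets nonneg_borel" and \<theta>: "\<theta> > 0"
    and int: "\<And>l. l > 0 \<Longrightarrow> integrable F (\<lambda>x. ln (1 + l * x))"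
    and mean: "dirichlet_mean_law \<theta> F \<mu>"
  shows "prob_space \<mu>" "sets \<mu> = sets borel" "AE m in \<mu>. 0 \<le> m"
    "l \<ge> 0 \<Longrightarrow> (\<integral>m. (1 + l * m) powr (- \<theta>) \<partial>\<mu>) = exp (- \<theta> * psi F l)"
proof -
  obtain W :: "real measure measure" and P where DP: "dirichlet_process W \<theta> F P"
    and \<mu>: "\<mu> = distr W borel (\<lambda>\<omega>. \<integral>x. x \<partial>P \<omega>)"
    using mean unfolding dirichlet_mean_law_def by blast
  interpret W: prob_space W using DP by (simp add: dirichlet_process_def)
  have spF: "space F = {0..}"
    using sets_eq_imp_space_eq[OF F(2)] by simp
  have id [measurable]: "(\<lambda>x. x) \<in> borel_measurable F"
    unfolding measurable_cong_sets[OF F(2) refl] by (rule borel_measurable_nonneg_borel) measurable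
  have [measurable]: "(\<lambda>\<omega>. \<integral>x. x \<partial>P \<omega>) \<in> borel_measurable W"
    by (rule measurable_compose[OF dirichlet_process_measurable[OF DP]]) measurable
  show "prob_space \<mu>"
    unfolding \<mu> by (rule W.prob_space_distr) measurable
  show "sets \<mu> = sets borel"
    by (simp add: \<mu>)
  show "AE m in \<mu>. 0 \<le> m"
    unfolding \<mu>
  proof (subst AE_distr_iff)
    show "AE \<omega> in W. 0 \<le> (\<integral>x. x \<partial>P \<omega>)"
      using dirichlet_process_kernel(3)[OF DP] spF by (intro AE_I2 integral_nonneg_AE) auto
  qed auto
  show "(\<integral>m. (1 + l * m) powr (- \<theta>) \<partial>\<mu>) = exp (- \<theta> * psi F l)" if "l \<ge> 0"
    using Markov_Krein(2)[OF DP F(1) \<theta> id _ int that] spF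
    by (simp add: \<mu> integral_distr psi_def)
qed

text \<open>
  A mean law for one base distribution comes with a process, whose image under \<open>f\<close> is a Dirichlet
  process for the image distribution.
\<close>

lemma dirichlet_mean_law_distr:
  assumes "dirichlet_mean_law \<theta> F \<mu>" "f \<in> F \<rightarrow>\<^sub>M K"
  shows "\<exists>\<mu>'. dirichlet_mean_law \<theta> (distr F K f) \<mu>'"
  using assms dirichlet_process_distr unfolding dirichlet_mean_law_def by metis

text \<open>
  Conditionally on the second factor \<open>m\<close> this is the Laplace transform of the gamma law at \<open>l * m\<close>.
\<close>

lemma Laplace_gamma_product:
  assumes \<mu>: "prob_space \<mu>" and sets [measurable_cong]: "sets \<mu> = sets borel" and nn: "AE m in \<mu>. 0 \<le> m"
    and \<theta>: "\<theta> > 0" and l: "l \<ge> 0"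
  shows "(\<integral>t. exp (- l * t) \<partial>distr (gamma_law \<theta> \<Otimes>\<^sub>M \<mu>) borel (\<lambda>(g, m). g * m)) = (\<integral>m. (1 + l * m) powr (- \<theta>) \<partial>\<mu>)"
proof -
  interpret G: prob_space "gamma_law \<theta>"
    using \<theta> by (intro prob_space_gamma_law) simp
  interpret \<mu>: prob_space \<mu> by fact
  interpret P: pair_prob_space "gamma_law \<theta>" \<mu> ..
  have "(\<integral>\<^sup>+t. ennreal (exp (- l * t)) \<partial>distr (gamma_law \<theta> \<Otimes>\<^sub>M \<mu>) borel (\<lambda>(g, m). g * m)) =
      (\<integral>\<^sup>+x. ennreal (exp (- l * (fst x * snd x))) \<partial>(gamma_law \<theta> \<Otimes>\<^sub>M \<mu>))"
    by (subst nn_integral_distr) (auto simp: case_prod_beta')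
  also have "\<dots> = (\<integral>\<^sup>+m. (\<integral>\<^sup>+g. ennreal (exp (- ((l * m) * g))) \<partial>gamma_law \<theta>) \<partial>\<mu>)"
    by (subst P.nn_integral_snd[symmetric]) (auto simp: mult_ac)
  also have "\<dots> = (\<integral>\<^sup>+m. ennreal ((1 + l * m) powr (- \<theta>)) \<partial>\<mu>)"
    by (rule nn_integral_cong_AE, use nn in eventually_elim)
       (use l \<theta> in \<open>simp add: nn_integral_gamma_law_exp\<close>)
  finally have *: "(\<integral>\<^sup>+t. ennreal (exp (- l * t)) \<partial>distr (gamma_law \<theta> \<Otimes>\<^sub>M \<mu>) borel (\<lambda>(g, m). g * m)) = \<dots>" .
  show ?thesis
    by (subst (1 2) integral_eq_nn_integral) (use * in auto)
qed

lemma AE_gamma_product_nonneg: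
  assumes \<mu>: "prob_space \<mu>" and sets [measurable_cong]: "sets \<mu> = sets borel" and nn: "AE m in \<mu>. 0 \<le> m"
    and \<theta>: "\<theta> > 0"
  shows "AE t in distr (gamma_law \<theta> \<Otimes>\<^sub>M \<mu>) borel (\<lambda>(g, m). g * m). 0 \<le> t"
proof -
  interpret G: prob_space "gamma_law \<theta>"
    using \<theta> by (intro prob_space_gamma_law) simp
  interpret \<mu>: prob_space \<mu> by fact
  interpret P: pair_prob_space "gamma_law \<theta>" \<mu> ..
  have "AE g in gamma_law \<theta>. AE m in \<mu>. 0 \<le> g * m"
    using AE_gamma_law_pos[OF \<theta>] by eventually_elim (use nn in eventually_elim, auto)
  moreover have "{x \<in> space (gamma_law \<theta> \<Otimes>\<^sub>M \<mu>). 0 \<le> fst x * snd x} \<in> sets (gamma_law \<theta> \<Otimes>\<^sub>M \<mu>)"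
    by measurable
  ultimately have "AE x in gamma_law \<theta> \<Otimes>\<^sub>M \<mu>. 0 \<le> fst x * snd x"
    by (intro P.AE_pair_measure) simp_all
  then show ?thesis
    by (subst AE_distr_iff) (auto simp: case_prod_beta')
qed

text \<open>
  Take logarithms in \<open>1 + l * (c * x / (c * x + 1)) = (1 + c * (1 + l) * x) / (1 + c * x)\<close>.
\<close>

lemma psi_odds_inverse:
  assumes F: "sets F = sets nonneg_borel" and int: "\<And>l. l > 0 \<Longrightarrow> integrable F (\<lambda>x. ln (1 + l * x))" and c: "c > 0" and l: "l \<ge> 0"
  defines "A \<equiv> distr F nonneg_borel (\<lambda>x. c * x / (c * x + 1))"
  shows "integrable A (\<lambda>y. ln (1 + l * y))" "psi A l = psi F (c * (1 + l)) - psi F c"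
proof -
  have spF: "space F = {0..}"
    using sets_eq_imp_space_eq[OF F] by simp
  have m: "(\<lambda>x. c * x / (c * x + 1)) \<in> F \<rightarrow>\<^sub>M nonneg_borel"
    unfolding measurable_cong_sets[OF F refl] using c by (rule measurable_odds_inverse)
  have ln_meas: "(\<lambda>y. ln (1 + l * y)) \<in> borel_measurable nonneg_borel"
    by (rule borel_measurable_nonneg_borel) measurable
  have eq: "ln (1 + l * (c * x / (c * x + 1))) = ln (1 + c * (1 + l) * x) - ln (1 + c * x)" if "x \<in> space F" for x
  proof -
    have x: "x \<ge> 0" using that spF by simp
    then have p: "1 + c * x > 0" "1 + c * (1 + l) * x > 0"
      using c l by (auto intro!: add_pos_nonneg)
    have "1 + l * (c * x / (c * x + 1)) = (1 + c * (1 + l) * x) / (1 + c * x)"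
      using p by (simp add: field_simps)
    then show ?thesis
      using p by (simp add: ln_div)
  qed
  have i: "integrable F (\<lambda>x. ln (1 + c * (1 + l) * x))" "integrable F (\<lambda>x. ln (1 + c * x))"
    using int c l by auto
  then have "integrable F (\<lambda>x. ln (1 + l * (c * x / (c * x + 1))))"
    by (subst Bochner_Integration.integrable_cong[OF refl eq]) auto
  then show "integrable A (\<lambda>y. ln (1 + l * y))"
    unfolding A_def by (subst integrable_distr_eq[OF m ln_meas])
  show "psi A l = psi F (c * (1 + l)) - psi F c"
    unfolding psi_def A_def using i
    by (subst integral_distr[OF m ln_meas], subst Bochner_Integration.integral_cong[OF refl eq]) auto
qed

text \<open>
  The density of \<open>T'\<close> is that of \<open>c * T\<close> multiplied by \<open>C * exp (- t)\<close>.
\<close>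

lemma Laplace_exponential_tilt:
  fixes g :: "real \<Rightarrow> real"
  assumes T: "distributed W lborel T (\<lambda>t. ennreal (g t))" and g: "\<And>t. 0 \<le> g t" and nn: "AE \<omega> in W. 0 \<le> T \<omega>"
    and T': "distributed N lborel T' (\<lambda>t. ennreal (if 0 < t then exp (- t) * (1 / c) * g (t / c) * C else 0))"
    and c: "c > 0" "C \<ge> 0"
  shows "(\<integral>\<omega>. exp (- l * T' \<omega>) \<partial>N) = C * (\<integral>\<omega>. exp (- c * (1 + l) * T \<omega>) \<partial>W)"
proof -
  have g_meas [measurable]: "g \<in> borel_measurable borel"
    using distributed_real_measurable[OF g T] by simp
  have [measurable]: "T \<in> borel_measurable W"
    using distributed_measurable[OF T] by simp
  have "AE t in distr W lborel T. 0 \<le> t"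
    using nn by (subst AE_distr_iff) auto
  then have "AE t in lborel. 0 < g t \<longrightarrow> 0 \<le> t"
    unfolding distributed_distr_eq_density[OF T] by (simp add: AE_density)
  then have AE: "AE t in lborel. 0 < g t \<longrightarrow> 0 < t"
    using AE_lborel_singleton[of 0] by eventually_elim auto
  let ?f = "\<lambda>t. if 0 < t then exp (- t) * (1 / c) * g (t / c) * C else 0"
  have "(\<integral>\<omega>. exp (- l * T' \<omega>) \<partial>N) = (\<integral>t. ?f t * exp (- l * t) \<partial>lborel)"
    using c g by (subst distributed_integral[OF T']) auto
  also have "\<dots> = c * (\<integral>s. ?f (c * s) * exp (- l * (c * s)) \<partial>lborel)"
    using lborel_integral_real_affine[of c "\<lambda>t. ?f t * exp (- l * t)" 0] c by (simp cong: if_cong)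
  also have "\<dots> = (\<integral>s. c * (?f (c * s) * exp (- l * (c * s))) \<partial>lborel)"
    by simp
  also have "\<dots> = (\<integral>s. C * (g s * exp (- c * (1 + l) * s)) \<partial>lborel)"
  proof (rule integral_cong_AE)
    show "AE s in lborel. c * (?f (c * s) * exp (- l * (c * s))) = C * (g s * exp (- c * (1 + l) * s))"
      using AE
    proof eventually_elim
      case (elim s)
      show ?case
      proof (cases "s > 0")
        case True
        have "exp (- (c * s)) * exp (- l * (c * s)) = exp (- c * (1 + l) * s)"
          by (simp add: exp_add[symmetric] algebra_simps)
        then show ?thesis
          using True c by (simp add: mult_ac)
      next
        case False
        with elim g[of s] have "g s = 0" by force
        with False c show ?thesis by (simp add: zero_less_mult_iff)
      qed
    qed
  qed measurable
  also have "\<dots> = C * (\<integral>s. g s * exp (- c * (1 + l) * s) \<partial>lborel)"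
    by simp
  also have "(\<integral>s. g s * exp (- c * (1 + l) * s) \<partial>lborel) = (\<integral>\<omega>. exp (- c * (1 + l) * T \<omega>) \<partial>W)"
    using g by (subst distributed_integral[OF T]) auto
  finally show ?thesis .
qed

theorem theorem3p1:
  fixes S :: "'s measure" and X :: "'s \<Rightarrow> real" and FX :: "real measure" and FA :: "real \<Rightarrow> real measure"
    and \<theta> c :: real
    and W :: "'w measure" and G M T :: "'w \<Rightarrow> real" and g :: "real \<Rightarrow> real"
    and N :: "'n measure" and T' :: "'n \<Rightarrow> real"
  assumes X: "prob_space S" "X \<in> S \<rightarrow>\<^sub>M nonneg_borel"
    and FX: "FX = distr S nonneg_borel X"
    and psi_finite: "\<forall>l>0. integrable FX (\<lambda>x. ln (1 + l * x))"
    and FA: "\<forall>a>0. FA a = distr S nonneg_borel (\<lambda>s. a * X s / (a * X s + 1))"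
    and pos: "\<theta> > 0" "c > 0"
    and W: "prob_space W" "prob_space.indep_var W borel G borel M"
    and G: "distr W borel G = gamma_law \<theta>"
    and M: "dirichlet_mean_law \<theta> FX (distr W borel M)"
    and T: "T = (\<lambda>\<omega>. G \<omega> * M \<omega>)"
    and g: "\<forall>t. 0 \<le> g t" "distributed W lborel T (\<lambda>t. ennreal (g t))"
    and T': "prob_space N"
      "distributed N lborel T'
         (\<lambda>t. ennreal (if 0 < t then exp (- t) * (1 / c) * g (t / c) * exp (\<theta> * psi FX c) else 0))"
  shows
    "(\<forall>l\<ge>0.
        (\<integral>\<omega>. exp (- l * T' \<omega>) \<partial>N) =
          (\<integral>\<omega>. exp (- c * (1 + l) * T \<omega>) \<partial>W) / (\<integral>\<omega>. exp (- c * T \<omega>) \<partial>W) \<and>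
        (\<integral>\<omega>. exp (- c * (1 + l) * T \<omega>) \<partial>W) / (\<integral>\<omega>. exp (- c * T \<omega>) \<partial>W) =
          exp (- \<theta> * (psi FX (c * (1 + l)) - psi FX c))) \<and>
     is_GGC \<theta> (FA c) (distr N borel T') \<and>
     (\<forall>(V :: 'v measure) MA.
        prob_space V \<and> MA \<in> borel_measurable V \<and> dirichlet_mean_law \<theta> (FA c) (distr V borel MA) \<longrightarrow>
        (\<forall>\<xi>. (\<forall>x. 0 \<le> \<xi> x) \<and> distributed W lborel M (\<lambda>x. ennreal (\<xi> x)) \<longrightarrow>
           distributed V lborel MA
             (\<lambda>y. ennreal (if 0 < y \<and> y < 1
                then 1 / c * exp (\<theta> * psi FX c) * (1 - y) powr (\<theta> - 2) * \<xi> (y / (c * (1 - y)))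
                else 0))) \<and>
        (c = 1 \<longrightarrow>
         (\<forall>\<xi>. (\<forall>y. 0 \<le> \<xi> y) \<and> distributed V lborel MA (\<lambda>y. ennreal (\<xi> y)) \<longrightarrow>
           distributed W lborel M
             (\<lambda>x. ennreal (if 0 < x
                then (1 + x) powr (\<theta> - 2) * \<xi> (x / (1 + x)) * exp (- \<theta> * psi FX 1)
                else 0)))))"
proof -
  interpret W: prob_space W by fact
  interpret N: prob_space N by fact
  interpret S: prob_space S by fact
  define C where "C = exp (\<theta> * psi FX c)"
  have C: "C > 0" by (simp add: C_def)
  define \<mu> where "\<mu> = distr W borel M"
  have FX_prob: "prob_space FX"
    unfolding FX by (rule S.prob_space_distr[OF X(2)])
  have FX_sets: "sets FX = sets nonneg_borel"
    by (simp add: FX)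
  have int: "l > 0 \<Longrightarrow> integrable FX (\<lambda>x. ln (1 + l * x))" for l
    using psi_finite by blast
  have odds: "(\<lambda>x. c * x / (c * x + 1)) \<in> FX \<rightarrow>\<^sub>M nonneg_borel"
    unfolding measurable_cong_sets[OF FX_sets refl] using pos(2) by (rule measurable_odds_inverse)
  have FAc: "FA c = distr FX nonneg_borel (\<lambda>x. c * x / (c * x + 1))"
    using FA pos(2) distr_distr[OF measurable_odds_inverse[OF pos(2)] X(2)] by (simp add: FX o_def)
  have FA_prob: "prob_space (FA c)"
    unfolding FAc by (rule prob_space.prob_space_distr[OF FX_prob odds])
  have FA_sets: "sets (FA c) = sets nonneg_borel"
    by (simp add: FAc)
  have FA_int: "l > 0 \<Longrightarrow> integrable (FA c) (\<lambda>y. ln (1 + l * y))" for l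
    unfolding FAc using psi_odds_inverse(1)[OF FX_sets int pos(2)] by simp
  have psi_FA: "l \<ge> 0 \<Longrightarrow> psi (FA c) l = psi FX (c * (1 + l)) - psi FX c" for l
    unfolding FAc by (rule psi_odds_inverse(2)[OF FX_sets int pos(2)])
  have \<mu>: "prob_space \<mu>" "sets \<mu> = sets borel" "AE m in \<mu>. 0 \<le> m"
    "\<And>l. l \<ge> 0 \<Longrightarrow> (\<integral>m. (1 + l * m) powr (- \<theta>) \<partial>\<mu>) = exp (- \<theta> * psi FX l)"
    unfolding \<mu>_def by (rule dirichlet_mean_law_Stieltjes[OF FX_prob FX_sets pos(1) int M]; assumption)+
  have FA_mean: "prob_space \<nu>" "sets \<nu> = sets borel" "AE m in \<nu>. 0 \<le> m"
    "\<And>l. l \<ge> 0 \<Longrightarrow> (\<integral>m. (1 + l * m) powr (- \<theta>) \<partial>\<nu>) = exp (- \<theta> * psi (FA c) l)"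
    if "dirichlet_mean_law \<theta> (FA c) \<nu>" for \<nu>
    by (rule dirichlet_mean_law_Stieltjes[OF FA_prob FA_sets pos(1) FA_int that]; assumption)+

  have M_meas [measurable]: "M \<in> borel_measurable W" and G_meas [measurable]: "G \<in> borel_measurable W"
    and joint: "distr W borel G \<Otimes>\<^sub>M distr W borel M = distr W (borel \<Otimes>\<^sub>M borel) (\<lambda>\<omega>. (G \<omega>, M \<omega>))"
    using W(2) unfolding W.indep_var_distribution_eq by auto
  have T_law: "distr W borel T = distr (gamma_law \<theta> \<Otimes>\<^sub>M \<mu>) borel (\<lambda>(g, m). g * m)"
    unfolding \<mu>_def G[symmetric] joint T by (subst distr_distr) (auto simp: o_def)
  have [measurable]: "T \<in> borel_measurable W"
    unfolding T by measurable
  have T_nn: "AE \<omega> in W. 0 \<le> T \<omega>"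
  proof -
    have "AE t in distr W borel T. 0 \<le> t"
      unfolding T_law by (rule AE_gamma_product_nonneg[OF \<mu>(1-3) pos(1)])
    then show ?thesis
      by (subst (asm) AE_distr_iff) auto
  qed
  have T_Laplace: "(\<integral>\<omega>. exp (- s * T \<omega>) \<partial>W) = exp (- \<theta> * psi FX s)" if "s \<ge> 0" for s
  proof -
    have "(\<integral>\<omega>. exp (- s * T \<omega>) \<partial>W) = (\<integral>t. exp (- s * t) \<partial>distr W borel T)"
      by (subst integral_distr) auto
    also have "\<dots> = exp (- \<theta> * psi FX s)"
      unfolding T_law using Laplace_gamma_product[OF \<mu>(1-3) pos(1) that] \<mu>(4)[OF that] by simp
    finally show ?thesis .
  qed
  have T'_Laplace: "(\<integral>\<omega>. exp (- l * T' \<omega>) \<partial>N) = C * (\<integral>\<omega>. exp (- c * (1 + l) * T \<omega>) \<partial>W)" for l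
    by (rule Laplace_exponential_tilt[OF g(2) _ T_nn T'(2)[folded C_def]]) (use g(1) pos C in auto)

  have part1: "(\<integral>\<omega>. exp (- l * T' \<omega>) \<partial>N) =
          (\<integral>\<omega>. exp (- c * (1 + l) * T \<omega>) \<partial>W) / (\<integral>\<omega>. exp (- c * T \<omega>) \<partial>W)"
    and part1': "(\<integral>\<omega>. exp (- c * (1 + l) * T \<omega>) \<partial>W) / (\<integral>\<omega>. exp (- c * T \<omega>) \<partial>W) =
          exp (- \<theta> * (psi FX (c * (1 + l)) - psi FX c))" if l: "l \<ge> 0" for l
  proof -
    have 1: "(\<integral>\<omega>. exp (- c * T \<omega>) \<partial>W) = inverse C"
      using T_Laplace[of c] pos by (simp add: C_def exp_minus)
    show "(\<integral>\<omega>. exp (- l * T' \<omega>) \<partial>N) =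
          (\<integral>\<omega>. exp (- c * (1 + l) * T \<omega>) \<partial>W) / (\<integral>\<omega>. exp (- c * T \<omega>) \<partial>W)"
      unfolding 1 T'_Laplace by (simp add: divide_inverse)
    have 2: "(\<integral>\<omega>. exp (- c * (1 + l) * T \<omega>) \<partial>W) = exp (- \<theta> * psi FX (c * (1 + l)))"
      using T_Laplace[of "c * (1 + l)"] pos l by simp
    show "(\<integral>\<omega>. exp (- c * (1 + l) * T \<omega>) \<partial>W) / (\<integral>\<omega>. exp (- c * T \<omega>) \<partial>W) =
          exp (- \<theta> * (psi FX (c * (1 + l)) - psi FX c))"
      unfolding 1 2 C_def by (simp add: exp_minus[symmetric] exp_add[symmetric] divide_inverse algebra_simps)
  qed

  have part2: "is_GGC \<theta> (FA c) (distr N borel T')"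
  proof -
    obtain \<mu>' where \<mu>': "dirichlet_mean_law \<theta> (FA c) \<mu>'"
      unfolding FAc using dirichlet_mean_law_distr[OF M odds] by blast
    note \<mu>'_props = FA_mean[OF \<mu>']
    interpret G: prob_space "gamma_law \<theta>"
      using pos by (intro prob_space_gamma_law) simp
    interpret \<mu>': prob_space \<mu>' by (rule \<mu>'_props)
    interpret pair: pair_prob_space "gamma_law \<theta>" \<mu>' ..
    note [measurable_cong] = \<mu>'_props(2)
    have [measurable]: "T' \<in> borel_measurable N"
      using distributed_measurable[OF T'(2)] by simp
    have "distr N borel T' = distr (gamma_law \<theta> \<Otimes>\<^sub>M \<mu>') borel (\<lambda>(g, m). g * m)"
    proof (rule Laplace_transform_unique)
      show "prob_space (distr N borel T')"
        by (rule N.prob_space_distr) measurable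
      show "prob_space (distr (gamma_law \<theta> \<Otimes>\<^sub>M \<mu>') borel (\<lambda>(g, m). g * m))"
        by (rule pair.prob_space_distr) measurable
      show "AE t in distr (gamma_law \<theta> \<Otimes>\<^sub>M \<mu>') borel (\<lambda>(g, m). g * m). 0 \<le> t"
        by (rule AE_gamma_product_nonneg[OF \<mu>'_props(1-3) pos(1)])
      have "AE t in distr N lborel T'. 0 \<le> t"
        unfolding distributed_distr_eq_density[OF T'(2)]
        by (subst AE_density[OF distributed_borel_measurable[OF T'(2)]]) (auto intro!: AE_I2)
      then have "AE \<omega> in N. 0 \<le> T' \<omega>"
        by (subst (asm) AE_distr_iff) auto
      then show "AE t in distr N borel T'. 0 \<le> t"
        by (subst AE_distr_iff) auto
      show "(\<integral>t. exp (- l * t) \<partial>distr N borel T') =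
          (\<integral>t. exp (- l * t) \<partial>distr (gamma_law \<theta> \<Otimes>\<^sub>M \<mu>') borel (\<lambda>(g, m). g * m))" if l: "l \<ge> 0" for l
      proof -
        have "(\<integral>t. exp (- l * t) \<partial>distr N borel T') = (\<integral>\<omega>. exp (- l * T' \<omega>) \<partial>N)"
          by (subst integral_distr) auto
        also have "\<dots> = exp (- \<theta> * psi (FA c) l)"
          unfolding part1[OF l] part1'[OF l] psi_FA[OF l] ..
        also have "\<dots> = (\<integral>t. exp (- l * t) \<partial>distr (gamma_law \<theta> \<Otimes>\<^sub>M \<mu>') borel (\<lambda>(g, m). g * m))"
          unfolding Laplace_gamma_product[OF \<mu>'_props(1-3) pos(1) l] \<mu>'_props(4)[OF l] ..
        finally show ?thesis .
      qed
    qed simp_all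
    with \<mu>' show ?thesis
      unfolding is_GGC_def by blast
  qed

  \<comment> \<open>The normalising constant of the tilt is dictated by the transform of \<open>\<mu>\<close> at \<open>c\<close>.\<close>
  have C_total: "C * (\<integral>m. (1 + c * m) powr (- \<theta>) \<partial>\<mu>) = 1"
    using \<mu>(4)[of c] pos by (simp add: C_def exp_minus)
  have FA_mean_law: "\<nu> = stieltjes_tilt \<theta> c C \<mu>" if \<nu>: "dirichlet_mean_law \<theta> (FA c) \<nu>" for \<nu>
  proof (rule Stieltjes_transform_unique[OF FA_mean(1-3)[OF \<nu>] _ _ _ pos(1)])
    show "prob_space (stieltjes_tilt \<theta> c C \<mu>)"
      using prob_space_stieltjes_tilt[OF \<mu>(1-3) pos(2) _ _ C_total] pos C by simp
    show "AE y in stieltjes_tilt \<theta> c C \<mu>. 0 \<le> y"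
      using AE_stieltjes_tilt[OF \<mu>(2,3) pos(2)] by (rule AE_mp) auto
    fix l :: real assume l: "l > 0"
    have "(\<integral>y. (1 + l * y) powr (- \<theta>) \<partial>stieltjes_tilt \<theta> c C \<mu>) = C * exp (- \<theta> * psi FX (c * (1 + l)))"
      using Stieltjes_transform_of_tilt[OF \<mu>(2,3) pos(2), of C l \<theta>] \<mu>(4)[of "c * (1 + l)"] C l pos by simp
    also have "\<dots> = exp (- \<theta> * psi (FA c) l)"
      using l by (simp add: psi_FA C_def exp_add[symmetric] algebra_simps)
    also have "\<dots> = (\<integral>y. (1 + l * y) powr (- \<theta>) \<partial>\<nu>)"
      using FA_mean(4)[OF \<nu>, of l] l by simp
    finally show "(\<integral>y. (1 + l * y) powr (- \<theta>) \<partial>\<nu>) = (\<integral>y. (1 + l * y) powr (- \<theta>) \<partial>stieltjes_tilt \<theta> c C \<mu>)" ..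
  qed simp

  have part3: "distributed V lborel MA
       (\<lambda>y. ennreal (if 0 < y \<and> y < 1
          then 1 / c * exp (\<theta> * psi FX c) * (1 - y) powr (\<theta> - 2) * \<xi> (y / (c * (1 - y)))
          else 0))"
    if V: "MA \<in> borel_measurable V" "dirichlet_mean_law \<theta> (FA c) (distr V borel MA)"
      and \<xi>: "\<forall>x. 0 \<le> \<xi> x" "distributed W lborel M (\<lambda>x. ennreal (\<xi> x))"
    for V :: "'v measure" and MA \<xi>
  proof -
    have [measurable]: "\<xi> \<in> borel_measurable borel"
      using distributed_real_measurable[OF _ \<xi>(2)] \<xi>(1) by simp
    have "\<mu> = density lborel (\<lambda>x. ennreal (\<xi> x))"
      using distributed_distr_eq_density[OF \<xi>(2)] unfolding \<mu>_def by (simp cong: distr_cong)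
    from stieltjes_tilt_density[OF this \<mu>(3) pos(2), of C \<theta>]
    have "distr V lborel MA = density lborel (\<lambda>y. ennreal (if 0 < y \<and> y < 1
          then 1 / c * C * (1 - y) powr (\<theta> - 2) * \<xi> (y / (c * (1 - y))) else 0))"
      using FA_mean_law[OF V(2)] \<xi>(1) C by (simp cong: distr_cong)
    then show ?thesis
      using V(1) unfolding distributed_def C_def by simp
  qed
  have part4: "distributed W lborel M
       (\<lambda>x. ennreal (if 0 < x
          then (1 + x) powr (\<theta> - 2) * \<xi> (x / (1 + x)) * exp (- \<theta> * psi FX 1)
          else 0))"
    if V: "MA \<in> borel_measurable V" "dirichlet_mean_law \<theta> (FA c) (distr V borel MA)" and c: "c = 1"
      and \<xi>: "\<forall>x. 0 \<le> \<xi> x" "distributed V lborel MA (\<lambda>y. ennreal (\<xi> y))"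
    for V :: "'v measure" and MA \<xi>
  proof -
    have [measurable]: "\<xi> \<in> borel_measurable borel"
      using distributed_real_measurable[OF _ \<xi>(2)] \<xi>(1) by simp
    have "stieltjes_tilt \<theta> c C \<mu> = density lborel (\<lambda>x. ennreal (\<xi> x))"
      using distributed_distr_eq_density[OF \<xi>(2)] FA_mean_law[OF V(2)] by (simp cong: distr_cong)
    from density_of_stieltjes_tilt[OF \<mu>(2,3) pos(2) C this]
    have "\<mu> = density lborel (\<lambda>x. ennreal (if 0 < x
        then c * (1 + c * x) powr (\<theta> - 2) * \<xi> (c * x / (1 + c * x)) / C else 0))"
      using \<xi>(1) by simp
    also have "(\<lambda>x. if 0 < x then c * (1 + c * x) powr (\<theta> - 2) * \<xi> (c * x / (1 + c * x)) / C else 0) =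
        (\<lambda>x. if 0 < x then (1 + x) powr (\<theta> - 2) * \<xi> (x / (1 + x)) * exp (- \<theta> * psi FX 1) else 0)"
      unfolding C_def \<open>c = 1\<close> by (auto simp: fun_eq_iff exp_minus divide_inverse)
    finally have "distr W lborel M = density lborel (\<lambda>x. ennreal (if 0 < x
          then (1 + x) powr (\<theta> - 2) * \<xi> (x / (1 + x)) * exp (- \<theta> * psi FX 1) else 0))"
      unfolding \<mu>_def by (simp cong: distr_cong)
    then show ?thesis
      unfolding distributed_def by simp
  qed
  show ?thesis
    using part1 part1' part2 part3 part4 by blast
qed

end
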